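(* Under either the S--S model or the W--S model (with the corresponding transition matrix $\boldsymbol P_\theta$ given in the context), the distribution of $L$, the length of the shooter's hand, has the form $$f(x,\theta):=\mathrm P_\theta(L=x)=\sum_{i=1}^4 c_i(\theta)\,e_i(\theta)^{x-1}(1-e_i(\theta))=\sum_{i=1}^4 c_i(\theta)\,\mathrm{GEOM}[1-e_i(\theta)](x),\qquad x\in\{2,3,4,\ldots\},$$ where $1>e_1(\theta)>e_2(\theta)>e_3(\theta)>e_4(\theta)>0$ are the non-unit eigenvalues of $\boldsymbol P_\theta$, and $c_1(\theta)>0$, $c_2(\theta)<0$, $c_3(\theta)<0$, and $c_4(\theta)<0$ are suitably defined functions satisfying $$c_1(\theta)+c_2(\theta)+c_3(\theta)+c_4(\theta)=1$$ and $$c_1(\theta)e_1(\theta)+c_2(\theta)e_2(\theta)+c_3(\theta)e_3(\theta)+c_4(\theta)e_4(\theta)=1.$$ More precisely, these quantities are given by the following formulas. **(S--S model.)** Let \begin{align*} q(\theta)&:=727417856+1090622976\,\theta+592227264\,\theta^2+146776064\,\theta^3+18260400\,\theta^4+1567554\,\theta^5+85295\,\theta^6,\\ r(\theta)&:=2(314528+263680\,\theta+74334\,\theta^2+9592\,\theta^3+527\,\theta^4),\\ s(\theta)&:=(8+\theta)(22784+13520\,\theta+2171\,\theta^2),\\ t(\theta)&:=22336+10480\,\theta+1123\,\theta^2. \end{align*} Then $e_1(\theta)=e(1,1,\theta)$, $e_2(\theta)=e(1,-1,\theta)$, $e_3(\theta)=e(-1,1,\theta)$, $e_4(\theta)=e(-1,-1,\theta)$,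 where $$e(u,v,\theta):=\frac58-\frac{\theta}{64}+\frac{u}{576}\sqrt{\frac{t(\theta)+8\alpha(\theta)}{3}}+\frac{v}{576}\sqrt{\frac{2t(\theta)-8\alpha(\theta)}{3}-6\,u\,s(\theta)\sqrt{\frac{3}{t(\theta)+8\alpha(\theta)}}}$$ with $$\alpha(\theta):=2\sqrt{r(\theta)}\cos\left[\frac13\cos^{-1}\left(-\frac{q(\theta)}{2\,r(\theta)^{3/2}}\right)\right].$$ With $$c(e_1,e_2,e_3,e_4,\theta):=\frac{(3-4e_1)(26+\theta-36e_1)(100-\theta-144e_1)\prod_{i=2}^4(20+\theta-24e_i)}{1152(2+\theta)(8+\theta)(20+7\theta)(e_2-e_1)(e_3-e_1)(e_4-e_1)},$$ we have \begin{align*} c_1(\theta)&=c(e_1(\theta),e_2(\theta),e_3(\theta),e_4(\theta),\theta),\\ c_2(\theta)&=c(e_2(\theta),e_3(\theta),e_4(\theta),e_1(\theta),\theta),\\ c_3(\theta)&=c(e_3(\theta),e_4(\theta),e_1(\theta),e_2(\theta),\theta),\\ c_4(\theta)&=c(e_4(\theta),e_1(\theta),e_2(\theta),e_3(\theta),\theta). \end{align*} **(W--S model.)** Let \begin{align*} q(\theta)&:=710369+258462\,\theta-63957\,\theta^2-5832\,\theta^3+6027\,\theta^4+522\,\theta^5-55\,\theta^6,\\ r(\theta)&:=9829+1356\,\theta-238\,\theta^2+12\,\theta^3+\theta^4,\\ s(\theta)&:=1068+246\,\theta+5\,\theta^2-2\,\theta^3,\\ t(\theta)&:=349+48\,\theta-2\,\theta^2.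 \end{align*} Then $e_1(\theta)=e(1,1,\theta)$, $e_2(\theta)=e(1,-1,\theta)$, $e_3(\theta)=e(-1,1,\theta)$, $e_4(\theta)=e(-1,-1,\theta)$, where $$e(u,v,\theta):=\frac58+\frac{\theta}{12}+\frac{u}{72}\sqrt{\frac{t(\theta)+\alpha(\theta)}{3}}+\frac{v}{72}\sqrt{\frac{2t(\theta)-\alpha(\theta)}{3}-2\,u\,s(\theta)\sqrt{\frac{3}{t(\theta)+\alpha(\theta)}}}$$ with $$\alpha(\theta):=2\sqrt{r(\theta)}\cos\left[\frac13\cos^{-1}\left(-\frac{q(\theta)}{r(\theta)^{3/2}}\right)\right].$$ With \begin{align*} c(e_1,e_2,e_3,e_4,\theta):={}&\Big[69984(9+\theta-12e_1)(13+2\theta-18e_1)(25+3\theta-36e_1)\\ &\quad\cdot(e_2-e_3)(e_2-e_4)(e_3-e_4)\prod_{i=2}^4(15+2\theta-18e_i)\Big]\Big/d(\theta) \end{align*} and \begin{align*} d(\theta):={}&(3+\theta)(5+\theta)\big[544195584\,(e_1(\theta)^2e_2(\theta)^3e_3(\theta)+e_1(\theta)^3e_2(\theta)e_3(\theta)^2\\ &+e_1(\theta)e_2(\theta)^2e_3(\theta)^3+e_1(\theta)^3e_2(\theta)^2e_4(\theta)+e_1(\theta)^2e_2(\theta)e_4(\theta)^3\\ &+e_1(\theta)e_2(\theta)^3e_4(\theta)^2+e_1(\theta)^2e_3(\theta)^3e_4(\theta)+e_1(\theta)^3e_3(\theta)e_4(\theta)^2\\ &+e_1(\theta)e_3(\theta)^2e_4(\theta)^3+e_2(\theta)^3e_3(\theta)^2e_4(\theta)+e_2(\theta)^2e_3(\theta)e_4(\theta)^3\\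 &+e_2(\theta)e_3(\theta)^3e_4(\theta)^2)-(448331256+349805385\,\theta+113332133\,\theta^2\\ &+19480471\,\theta^3+1870151\,\theta^4+94864\,\theta^5+1980\,\theta^6)\big], \end{align*} we have \begin{align*} c_1(\theta)&=c(e_1(\theta),e_2(\theta),e_3(\theta),e_4(\theta),\theta),\\ c_2(\theta)&=-c(e_2(\theta),e_3(\theta),e_4(\theta),e_1(\theta),\theta),\\ c_3(\theta)&=c(e_3(\theta),e_4(\theta),e_1(\theta),e_2(\theta),\theta),\\ c_4(\theta)&=-c(e_4(\theta),e_1(\theta),e_2(\theta),e_3(\theta),\theta). \end{align*}
   Context: **Craps and hand length.** The shooter repeatedly rolls two dice. Starting with a come-out roll: if the total is 2, 3, 7, 11 or 12, the pass-line decision is resolved and the next roll is again a come-out roll; otherwise the total (4, 5, 6, 8, 9 or 10) becomes the point, and subsequent rolls (point rolls) continue until either the point reappears (then the next roll is a new come-out roll) or a 7 appears (a "seven-out", ending the shooter's hand). The length $L$ of the shooter's hand is the number of rolls from the initial come-out roll through the seven-out, inclusive. Both dice-control models below have a parameter $\theta\in[0,1]$ (level of control); rolls are independent, with the distribution of the total depending on whether the roll is a come-out roll or a point roll, and on the point. Under both models $L$ is the absorption time (number of steps to reach state 7o) of the Markov chain with states co (coming out), p4-10 (point 4 or 10), p5-9 (point 5 or 9), p6-8 (point 6 or 8), 7o (sevened out), in this order, started at co, with one-step transition matrix $\boldsymbol P_\theta$ given below. $\mathrm P_\theta$ denotes probability under parameter $\theta$. **S--S (modified Smith--Scott) model.**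 With $S=\{1,2,3,4,5,6\}$, $A=\{2,3,4,5\}$, $B=\{1,3,4,6\}$, $C=\{1,2,5,6\}$, the dice set $UV$ ($U,V\in\{A,B,C\}$) gives the two dice the joint distribution $(1-\theta)\,\mathrm{UNIF}[S\times S]+\theta\,\mathrm{UNIF}[U\times V]$, where $\mathrm{UNIF}$ denotes the uniform distribution on the indicated set. The set $AA$ is used on come-out rolls, $AC$ when the point is 4, 5, 9 or 10, and $AB$ when the point is 6 or 8. The transition matrix is $$\boldsymbol P_\theta=\frac{1}{144}\begin{pmatrix}12(4-\theta)&6(4-\theta)&4(8+\theta)&2(20+7\theta)&0\\6(2+\theta)&108&0&0&6(4-\theta)\\2(8+\theta)&0&4(26+\theta)&0&6(4-\theta)\\20+7\theta&0&0&100-\theta&6(4-\theta)\\0&0&0&0&144\end{pmatrix}.$$ **W--S (Wong--Shackleford) model.** Write $\bar a:=7-a$. With dice set $(a,b,c,d)$ (top and front faces of the left die, then of the right die), the two dice show $(x,y)\in\{1,\ldots,6\}^2$ with probability $\frac1{36}+\frac{\theta}{36}$ if $(x,y)\in\{(a,c),(b,d),(\bar a,\bar c),(\bar b,\bar d)\}$, $\frac1{36}-\frac{\theta}{36}$ if $(x,y)\in\{(a,\bar c),(b,\bar d),(\bar a,c),(\bar b,d)\}$, and $\frac1{36}$ otherwise. The set $(1,5,6,2)$ is used on come-out rolls and $(2,4,2,4)$ on all point rolls. The transition matrix is $$\boldsymbol P_\theta=\frac{1}{36}\begin{pmatrix}2(6+\theta)&2(3-\theta)&8&10&0\\3+\theta&3(9+\theta)&0&0&2(3-2\theta)\\4&0&2(13+2\theta)&0&2(3-2\theta)\\5+\theta&0&0&25+3\theta&2(3-2\theta)\\0&0&0&0&36\end{pmatrix}.$$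 **Notation.** $\mathrm{GEOM}[p](x):=(1-p)^{x-1}p$ for $x\in\{1,2,3,\ldots\}$. $\cos^{-1}$ is the principal arccosine with values in $[0,\pi]$. The symbols $e(u,v,\theta)$, $c(\cdot)$, $\alpha,q,r,s,t$ have separate definitions for the two models.
   Formalization: The claim c_2(θ)<0 fails at θ=1 in both models, where two diagonal entries of P_θ coincide, equal e_2(1), and make c_2(1)=0; the formal theorem proves c_2(θ)<0 for 0≤θ<1 and c_2(1)=0, with everything else on all of [0,1]. *)

theory Defs
  imports "HOL-Probability.Probability" "Jordan_Normal_Form.Char_Poly"
begin

section \<open>The game\<close>

datatype dice_model = SS | WS

datatype game_state = Come_out | Point nat | Seven_out

fun next_state :: "game_state \<Rightarrow> nat \<Rightarrow> game_state" where
  "next_state Come_out n = (if n \<in> {2, 3, 7, 11, 12} then Come_out else Point n)"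
| "next_state (Point p) n = (if n = p then Come_out else if n = 7 then Seven_out else Point p)"
| "next_state Seven_out n = Seven_out"

text \<open>\<open>hand_state r n\<close> is the state after the first \<open>n\<close> rolls \<open>r 0, \<dots>, r (n - 1)\<close>;
  in particular \<open>r n\<close> is the roll made in state \<open>hand_state r n\<close>.\<close>

primrec hand_state :: "(nat \<Rightarrow> nat \<times> nat) \<Rightarrow> nat \<Rightarrow> game_state" where
  "hand_state r 0 = Come_out"
| "hand_state r (Suc n) = next_state (hand_state r n) (fst (r n) + snd (r n))"

text \<open>The infimum is \<open>\<infinity>\<close> if the shooter never sevens out.\<close>

definition hand_length :: "(nat \<Rightarrow> nat \<times> nat) \<Rightarrow> enat" where
  "hand_length r = (INF n\<in>{n. hand_state r n = Seven_out}. enat n)"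


section \<open>Dice control\<close>

definition ss_set_A :: "nat set" where "ss_set_A = {2, 3, 4, 5}"
definition ss_set_B :: "nat set" where "ss_set_B = {1, 3, 4, 6}"
definition ss_set_C :: "nat set" where "ss_set_C = {1, 2, 5, 6}"

definition ss_dice :: "real \<Rightarrow> nat set \<Rightarrow> nat set \<Rightarrow> nat \<times> nat \<Rightarrow> real" where
  "ss_dice \<theta> U V xy =
     (1 - \<theta>) * pmf (pmf_of_set ({1..6} \<times> {1..6})) xy + \<theta> * pmf (pmf_of_set (U \<times> V)) xy"

definition ws_dice :: "real \<Rightarrow> nat \<times> nat \<times> nat \<times> nat \<Rightarrow> nat \<times> nat \<Rightarrow> real" where
  "ws_dice \<theta> = (\<lambda>(a, b, c, d) xy.
     if xy \<notin> {1..6} \<times> {1..6} then 0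
     else if xy \<in> {(a, c), (b, d), (7 - a, 7 - c), (7 - b, 7 - d)} then 1 / 36 + \<theta> / 36
     else if xy \<in> {(a, 7 - c), (b, 7 - d), (7 - a, c), (7 - b, d)} then 1 / 36 - \<theta> / 36
     else 1 / 36)"

text \<open>The values at \<open>Seven_out\<close> are irrelevant: the hand is over.\<close>

fun dice_mass :: "dice_model \<Rightarrow> real \<Rightarrow> game_state \<Rightarrow> nat \<times> nat \<Rightarrow> real" where
  "dice_mass SS \<theta> (Point p) =
     (if p \<in> {6, 8} then ss_dice \<theta> ss_set_A ss_set_B else ss_dice \<theta> ss_set_A ss_set_C)"
| "dice_mass SS \<theta> _ = ss_dice \<theta> ss_set_A ss_set_A"
| "dice_mass WS \<theta> (Point p) = ws_dice \<theta> (2, 4, 2, 4)"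
| "dice_mass WS \<theta> _ = ws_dice \<theta> (1, 5, 6, 2)"

text \<open>Given the previous rolls, and as long as the hand is not over, the next roll has the
  distribution prescribed by the current state. Since the state is a function of the previous
  rolls, this determines the joint law of the rolls up to the end of the hand.\<close>

definition hand_rolls :: "dice_model \<Rightarrow> real \<Rightarrow> 'a measure \<Rightarrow> (nat \<Rightarrow> 'a \<Rightarrow> nat \<times> nat) \<Rightarrow> bool" where
  "hand_rolls mdl \<theta> M R \<longleftrightarrow> prob_space M \<and>
     (\<forall>n. R n \<in> measurable M (count_space UNIV)) \<and>
     (\<forall>n r. hand_state r n \<noteq> Seven_out \<longrightarrow>
        measure M {\<omega> \<in> space M. \<forall>k\<le>n. R k \<omega> = r k} =
        measure M {\<omega> \<in> space M. \<forall>k<n. R k \<omega> = r k} * dice_mass mdl \<theta> (hand_state r n) (r n))"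


section \<open>The transition matrices\<close>

text \<open>The states are co, p4-10, p5-9, p6-8, 7o, in this order.\<close>

definition trans_mat_ss :: "real \<Rightarrow> real mat" where
  "trans_mat_ss \<theta> = (1 / 144) \<cdot>\<^sub>m mat_of_rows_list 5
    [[12 * (4 - \<theta>), 6 * (4 - \<theta>), 4 * (8 + \<theta>),  2 * (20 + 7 * \<theta>), 0],
     [6 * (2 + \<theta>),  108,         0,            0,                6 * (4 - \<theta>)],
     [2 * (8 + \<theta>),  0,           4 * (26 + \<theta>), 0,                6 * (4 - \<theta>)],
     [20 + 7 * \<theta>,   0,           0,            100 - \<theta>,          6 * (4 - \<theta>)],
     [0,            0,           0,            0,                144]]"

definition trans_mat_ws :: "real \<Rightarrow> real mat" where
  "trans_mat_ws \<theta> = (1 / 36) \<cdot>\<^sub>m mat_of_rows_list 5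
    [[2 * (6 + \<theta>), 2 * (3 - \<theta>), 8,                10,         0],
     [3 + \<theta>,       3 * (9 + \<theta>), 0,                0,          2 * (3 - 2 * \<theta>)],
     [4,           0,           2 * (13 + 2 * \<theta>), 0,          2 * (3 - 2 * \<theta>)],
     [5 + \<theta>,       0,           0,                25 + 3 * \<theta>, 2 * (3 - 2 * \<theta>)],
     [0,           0,           0,                0,          36]]"

fun trans_mat :: "dice_model \<Rightarrow> real \<Rightarrow> real mat" where
  "trans_mat SS = trans_mat_ss"
| "trans_mat WS = trans_mat_ws"


section \<open>Eigenvalues and coefficients\<close>

text \<open>Geometric distribution on the positive integers.\<close>

definition GEOM :: "real \<Rightarrow> nat \<Rightarrow> real" where
  "GEOM p x = (1 - p) ^ (x - 1) * p"

subsection \<open>Smith--Scott model\<close>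

definition ss_q :: "real \<Rightarrow> real" where
  "ss_q \<theta> = 727417856 + 1090622976 * \<theta> + 592227264 * \<theta> ^ 2 + 146776064 * \<theta> ^ 3
     + 18260400 * \<theta> ^ 4 + 1567554 * \<theta> ^ 5 + 85295 * \<theta> ^ 6"

definition ss_r :: "real \<Rightarrow> real" where
  "ss_r \<theta> = 2 * (314528 + 263680 * \<theta> + 74334 * \<theta> ^ 2 + 9592 * \<theta> ^ 3 + 527 * \<theta> ^ 4)"

definition ss_s :: "real \<Rightarrow> real" where
  "ss_s \<theta> = (8 + \<theta>) * (22784 + 13520 * \<theta> + 2171 * \<theta> ^ 2)"

definition ss_t :: "real \<Rightarrow> real" where
  "ss_t \<theta> = 22336 + 10480 * \<theta> + 1123 * \<theta> ^ 2"

definition ss_\<alpha> :: "real \<Rightarrow> real" where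
  "ss_\<alpha> \<theta> = 2 * sqrt (ss_r \<theta>) * cos (1 / 3 * arccos (- ss_q \<theta> / (2 * ss_r \<theta> powr (3 / 2))))"

definition ss_e :: "real \<Rightarrow> real \<Rightarrow> real \<Rightarrow> real" where
  "ss_e u v \<theta> = 5 / 8 - \<theta> / 64
     + u / 576 * sqrt ((ss_t \<theta> + 8 * ss_\<alpha> \<theta>) / 3)
     + v / 576 * sqrt ((2 * ss_t \<theta> - 8 * ss_\<alpha> \<theta>) / 3
                        - 6 * u * ss_s \<theta> * sqrt (3 / (ss_t \<theta> + 8 * ss_\<alpha> \<theta>)))"

definition ss_c :: "real \<Rightarrow> real \<Rightarrow> real \<Rightarrow> real \<Rightarrow> real \<Rightarrow> real" where
  "ss_c e1 e2 e3 e4 \<theta> =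
     ((3 - 4 * e1) * (26 + \<theta> - 36 * e1) * (100 - \<theta> - 144 * e1)
       * ((20 + \<theta> - 24 * e2) * (20 + \<theta> - 24 * e3) * (20 + \<theta> - 24 * e4)))
     / (1152 * (2 + \<theta>) * (8 + \<theta>) * (20 + 7 * \<theta>) * (e2 - e1) * (e3 - e1) * (e4 - e1))"

subsection \<open>Wong--Shackleford model\<close>

definition ws_q :: "real \<Rightarrow> real" where
  "ws_q \<theta> = 710369 + 258462 * \<theta> - 63957 * \<theta> ^ 2 - 5832 * \<theta> ^ 3
     + 6027 * \<theta> ^ 4 + 522 * \<theta> ^ 5 - 55 * \<theta> ^ 6"

definition ws_r :: "real \<Rightarrow> real" where
  "ws_r \<theta> = 9829 + 1356 * \<theta> - 238 * \<theta> ^ 2 + 12 * \<theta> ^ 3 + \<theta> ^ 4"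

definition ws_s :: "real \<Rightarrow> real" where
  "ws_s \<theta> = 1068 + 246 * \<theta> + 5 * \<theta> ^ 2 - 2 * \<theta> ^ 3"

definition ws_t :: "real \<Rightarrow> real" where
  "ws_t \<theta> = 349 + 48 * \<theta> - 2 * \<theta> ^ 2"

definition ws_\<alpha> :: "real \<Rightarrow> real" where
  "ws_\<alpha> \<theta> = 2 * sqrt (ws_r \<theta>) * cos (1 / 3 * arccos (- ws_q \<theta> / ws_r \<theta> powr (3 / 2)))"

definition ws_e :: "real \<Rightarrow> real \<Rightarrow> real \<Rightarrow> real" where
  "ws_e u v \<theta> = 5 / 8 + \<theta> / 12
     + u / 72 * sqrt ((ws_t \<theta> + ws_\<alpha> \<theta>) / 3)
     + v / 72 * sqrt ((2 * ws_t \<theta> - ws_\<alpha> \<theta>) / 3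
                       - 2 * u * ws_s \<theta> * sqrt (3 / (ws_t \<theta> + ws_\<alpha> \<theta>)))"

definition ws_d :: "real \<Rightarrow> real" where
  "ws_d \<theta> =
     (let e1 = ws_e 1 1 \<theta>; e2 = ws_e 1 (- 1) \<theta>; e3 = ws_e (- 1) 1 \<theta>; e4 = ws_e (- 1) (- 1) \<theta> in
      (3 + \<theta>) * (5 + \<theta>) *
      (544195584 *
         (e1 ^ 2 * e2 ^ 3 * e3 + e1 ^ 3 * e2 * e3 ^ 2
        + e1 * e2 ^ 2 * e3 ^ 3 + e1 ^ 3 * e2 ^ 2 * e4 + e1 ^ 2 * e2 * e4 ^ 3
        + e1 * e2 ^ 3 * e4 ^ 2 + e1 ^ 2 * e3 ^ 3 * e4 + e1 ^ 3 * e3 * e4 ^ 2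
        + e1 * e3 ^ 2 * e4 ^ 3 + e2 ^ 3 * e3 ^ 2 * e4 + e2 ^ 2 * e3 * e4 ^ 3
        + e2 * e3 ^ 3 * e4 ^ 2)
       - (448331256 + 349805385 * \<theta> + 113332133 * \<theta> ^ 2 + 19480471 * \<theta> ^ 3
          + 1870151 * \<theta> ^ 4 + 94864 * \<theta> ^ 5 + 1980 * \<theta> ^ 6)))"

definition ws_c :: "real \<Rightarrow> real \<Rightarrow> real \<Rightarrow> real \<Rightarrow> real \<Rightarrow> real" where
  "ws_c e1 e2 e3 e4 \<theta> =
     (69984 * (9 + \<theta> - 12 * e1) * (13 + 2 * \<theta> - 18 * e1) * (25 + 3 * \<theta> - 36 * e1)
       * (e2 - e3) * (e2 - e4) * (e3 - e4)
       * ((15 + 2 * \<theta> - 18 * e2) * (15 + 2 * \<theta> - 18 * e3) * (15 + 2 * \<theta> - 18 * e4)))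
     / ws_d \<theta>"

subsection \<open>Both models\<close>

fun e_fun :: "dice_model \<Rightarrow> real \<Rightarrow> real \<Rightarrow> real \<Rightarrow> real" where
  "e_fun SS = ss_e"
| "e_fun WS = ws_e"

definition eig :: "dice_model \<Rightarrow> nat \<Rightarrow> real \<Rightarrow> real" where
  "eig mdl i \<theta> =
     (if i = 1 then e_fun mdl 1 1 \<theta>
      else if i = 2 then e_fun mdl 1 (- 1) \<theta>
      else if i = 3 then e_fun mdl (- 1) 1 \<theta>
      else e_fun mdl (- 1) (- 1) \<theta>)"

text \<open>The minus signs in the second model come from the factor
  \<open>(e2 - e3) * (e2 - e4) * (e3 - e4)\<close> of \<^const>\<open>ws_c\<close>, a Vandermonde product that is not
  invariant under cyclic shifts.

  At \<open>\<theta> = 1\<close> two diagonal entries of the transition matrix coincide (they are 3/4 in the first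
  model, 5/6 in the second), their common value is the second eigenvalue, and the second
  coefficient vanishes.\<close>

fun coef :: "dice_model \<Rightarrow> nat \<Rightarrow> real \<Rightarrow> real" where
  "coef SS i \<theta> =
     (let e1 = eig SS 1 \<theta>; e2 = eig SS 2 \<theta>; e3 = eig SS 3 \<theta>; e4 = eig SS 4 \<theta> in
      if i = 1 then ss_c e1 e2 e3 e4 \<theta>
      else if i = 2 then ss_c e2 e3 e4 e1 \<theta>
      else if i = 3 then ss_c e3 e4 e1 e2 \<theta>
      else ss_c e4 e1 e2 e3 \<theta>)"
| "coef WS i \<theta> =
     (let e1 = eig WS 1 \<theta>; e2 = eig WS 2 \<theta>; e3 = eig WS 3 \<theta>; e4 = eig WS 4 \<theta> in
      if i = 1 then ws_c e1 e2 e3 e4 \<theta>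
      else if i = 2 then - ws_c e2 e3 e4 e1 \<theta>
      else if i = 3 then ws_c e3 e4 e1 e2 \<theta>
      else - ws_c e4 e1 e2 e3 \<theta>)"


section \<open>The transition matrices and the existence of the process\<close>

fun chain_state :: "game_state \<Rightarrow> nat" where
  "chain_state Come_out = 0"
| "chain_state (Point p) = (if p \<in> {4, 10} then 1 else if p \<in> {5, 9} then 2 else 3)"
| "chain_state Seven_out = 4"

lemma sum_dice:
  "(\<Sum>xy | xy \<in> {1..6} \<times> {1..6} \<and> P xy. g xy) =
   (\<Sum>x\<leftarrow>[1, 2, 3, 4, 5, 6]. \<Sum>y\<leftarrow>[1, 2, 3, 4, 5, 6]. if P (x, y) then g (x, y) else (0 :: real))"
  for P :: "nat \<times> nat \<Rightarrow> bool"
proof -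
  have "{1..6::nat} = set [1, 2, 3, 4, 5, 6]"
    by auto
  then have *: "(\<Sum>x\<in>{1..6::nat}. h x) = (\<Sum>x\<leftarrow>[1, 2, 3, 4, 5, 6]. h x)" for h :: "nat \<Rightarrow> real"
    by (subst sum_list_distinct_conv_sum_set) auto
  have "(\<Sum>xy | xy \<in> {1..6} \<times> {1..6} \<and> P xy. g xy) =
      (\<Sum>xy\<in>{1..6} \<times> {1..6}. if P xy then g xy else 0)"
    by (subst sum.inter_filter) auto
  also have "\<dots> = (\<Sum>x\<in>{1..6}. \<Sum>y\<in>{1..6}. if P (x, y) then g (x, y) else 0)"
    by (subst sum.cartesian_product) (rule sum.cong, auto)
  finally show ?thesis
    unfolding * .
qed

lemma ss_dice_eq:
  assumes "card U = 4" "card V = 4" "a = (1 - \<theta>) / 36" "b = \<theta> / 16"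
  shows "ss_dice \<theta> U V (x, y) =
    (if x \<in> {1..6} \<and> y \<in> {1..6} then a else 0) + (if x \<in> U \<and> y \<in> V then b else 0)"
proof -
  have "card ({1..6::nat} \<times> {1..6::nat}) = 36"
    by (simp add: card_cartesian_product)
  moreover have fin: "finite U" "finite V" "U \<noteq> {}" "V \<noteq> {}"
    using assms(1,2) by (auto intro: card_ge_0_finite)
  moreover have "card (U \<times> V) = 16"
    using assms(1,2) by (simp add: card_cartesian_product)
  moreover have "U \<times> V \<noteq> {}" "{1..6::nat} \<times> {1..6::nat} \<noteq> {}"
    using fin by auto
  ultimately have "ss_dice \<theta> U V (x, y) =
      (1 - \<theta>) * (indicator ({1..6} \<times> {1..6}) (x, y) / 36) + \<theta> * (indicator (U \<times> V) (x, y) / 16)"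
    unfolding ss_dice_def by (subst (1 2) pmf_of_set) (simp_all del: atLeastAtMost_iff)
  also have "\<dots> = (if x \<in> {1..6} \<and> y \<in> {1..6} then a else 0) + (if x \<in> U \<and> y \<in> V then b else 0)"
    unfolding assms(3,4) indicator_def mem_Sigma_iff by (cases "x \<in> U \<and> y \<in> V"; cases "x \<in> {1..6} \<and> y \<in> {1..6}"; simp only: if_True if_False; simp)
  finally show ?thesis .
qed

lemma card_ss_sets: "card ss_set_A = 4" "card ss_set_B = 4" "card ss_set_C = 4"
  by (simp_all add: ss_set_A_def ss_set_B_def ss_set_C_def)

lemma mem_ss_sets:
  "x \<in> ss_set_A \<longleftrightarrow> x \<in> {2, 3, 4, 5}" "x \<in> ss_set_B \<longleftrightarrow> x \<in> {1, 3, 4, 6}"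
  "x \<in> ss_set_C \<longleftrightarrow> x \<in> {1, 2, 5, 6}"
  by (simp_all only: ss_set_A_def ss_set_B_def ss_set_C_def)

lemmas ss_dice_sets =
  ss_dice_eq[OF card_ss_sets(1) card_ss_sets(1), unfolded mem_ss_sets]
  ss_dice_eq[OF card_ss_sets(1) card_ss_sets(2), unfolded mem_ss_sets]
  ss_dice_eq[OF card_ss_sets(1) card_ss_sets(3), unfolded mem_ss_sets]

lemma ws_dice_eq:
  assumes "{(a', c'), (b', d'), (7 - a', 7 - c'), (7 - b', 7 - d')} = P"
    "{(a', 7 - c'), (b', 7 - d'), (7 - a', c'), (7 - b', d')} = N"
    "P \<union> N \<subseteq> {1..6} \<times> {1..6}" "P \<inter> N = {}" "a = 1 / 36" "b = \<theta> / 36"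
  shows "ws_dice \<theta> (a', b', c', d') (x, y) =
    (if x \<in> {1..6} \<and> y \<in> {1..6} then a else 0) + (if (x, y) \<in> P then b else 0)
      - (if (x, y) \<in> N then b else 0)"
proof -
  have iff: "(x \<in> {1..6} \<and> y \<in> {1..6}) = ((x, y) \<in> {1..6} \<times> {1..6})"
    by (rule mem_Sigma_iff[symmetric])
  have gen: "(if \<not> D then 0 else if p then 1 / 36 + \<theta> / 36 else if n then 1 / 36 - \<theta> / 36 else 1 / 36)
      = (if D then a else 0) + (if p then b else 0) - (if n then b else 0)"
    if "p \<longrightarrow> D" "n \<longrightarrow> D" "\<not> (p \<and> n)" for D p n
    using that assms(5,6) by simp
  show ?thesis
    unfolding ws_dice_def prod.case assms(1,2) iff
    by (rule gen) (use assms(3,4) in blast)+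
qed

lemma ws_dice_sets:
  assumes "a = 1 / 36" "b = \<theta> / 36"
  shows
  "ws_dice \<theta> (1, 5, 6, 2) (x, y) =
     (if x \<in> {1..6} \<and> y \<in> {1..6} then a else 0)
       + (if (x, y) \<in> {(1, 6), (5, 2), (6, 1), (2, 5)} then b else 0)
       - (if (x, y) \<in> {(1, 1), (5, 5), (6, 6), (2, 2)} then b else 0)"
  "ws_dice \<theta> (2, 4, 2, 4) (x, y) =
     (if x \<in> {1..6} \<and> y \<in> {1..6} then a else 0)
       + (if (x, y) \<in> {(2, 2), (4, 4), (5, 5), (3, 3)} then b else 0)
       - (if (x, y) \<in> {(2, 5), (4, 3), (5, 2), (3, 4)} then b else 0)"
  by (rule ws_dice_eq[OF _ _ _ _ assms]; simp)+

text \<open>From every state the game moves to the classes co, p4-10, p5-9, p6-8, 7o with the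
  probabilities in the corresponding row of the transition matrix.\<close>

lemma trans_mat_game:
  assumes s: "s \<in> {Come_out, Point 4, Point 5, Point 6, Point 8, Point 9, Point 10}" and j: "j < 5"
  shows "(\<Sum>xy | xy \<in> {1..6} \<times> {1..6} \<and> chain_state (next_state s (fst xy + snd xy)) = j.
            dice_mass mdl \<theta> s xy) = trans_mat mdl \<theta> $$ (chain_state s, j)"
proof -
  have j': "j \<in> {0, 1, 2, 3, 4}"
    using j by auto
  define a b where ab: "a = (1 - \<theta>) / 36" "b = \<theta> / 16"
  define c d where cd: "c = (1 / 36 :: real)" "d = \<theta> / 36"
  show ?thesis
    unfolding sum_dice
    using s j'
    by (cases mdl; simp only: insert_iff empty_iff simp_thms; elim disjE; hypsubst;
        simp cong: if_cong del: dice_mass.simps trans_mat.simps;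
        simp add: ss_dice_sets[OF ab] ws_dice_sets[OF cd, unfolded One_nat_def];
        simp add: mat_of_rows_list_def trans_mat_ss_def trans_mat_ws_def ab cd field_simps)
qed

lemma dice_mass_nonneg:
  assumes "0 \<le> \<theta>" "\<theta> \<le> 1"
  shows "0 \<le> dice_mass mdl \<theta> s xy"
proof -
  have "0 \<le> ss_dice \<theta> U V xy" for U V
    using assms by (simp add: ss_dice_def)
  moreover have "0 \<le> ws_dice \<theta> S xy" for S
    using assms by (cases S) (simp add: ws_dice_def)
  ultimately show ?thesis
    by (cases mdl; cases s) auto
qed

lemma dice_mass_outside:
  assumes "xy \<notin> {1..6} \<times> {1..6}"
  shows "dice_mass mdl \<theta> s xy = 0"
proof -
  obtain x y where xy: "xy = (x, y)"
    by (cases xy)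
  have sub: "ss_set_A \<subseteq> {1..6}" "ss_set_B \<subseteq> {1..6}" "ss_set_C \<subseteq> {1..6}"
    by (auto simp: ss_set_A_def ss_set_B_def ss_set_C_def)
  have ss: "ss_dice \<theta> U V xy = 0"
    if "U \<subseteq> {1..6}" "V \<subseteq> {1..6}" "card U = 4" "card V = 4" for U V
    using that assms unfolding xy by (subst ss_dice_eq[OF that(3,4) refl refl]) auto
  have ws: "ws_dice \<theta> S xy = 0" for S
    using assms by (cases S) (simp add: ws_dice_def)
  show ?thesis
    using ss[OF sub(1) sub(1) card_ss_sets(1) card_ss_sets(1)] ss[OF sub(1) sub(2) card_ss_sets(1) card_ss_sets(2)]
      ss[OF sub(1) sub(3) card_ss_sets(1) card_ss_sets(3)] ws
    by (cases mdl; cases s) simp_all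
qed

lemma dice_mass_sum: "(\<Sum>xy\<in>{1..6} \<times> {1..6}. dice_mass mdl \<theta> s xy) = 1"
proof -
  have eq: "(\<Sum>xy\<in>{1..6} \<times> {1..6}. g xy) =
      (\<Sum>x\<leftarrow>[1, 2, 3, 4, 5, 6]. \<Sum>y\<leftarrow>[1, 2, 3, 4, 5, 6]. g (x, y))" for g :: "nat \<times> nat \<Rightarrow> real"
    using sum_dice[of g "\<lambda>_. True"] by (simp only: simp_thms if_True Collect_mem_eq)
  define a b where ab: "a = (1 - \<theta>) / 36" "b = \<theta> / 16"
  define c d where cd: "c = (1 / 36 :: real)" "d = \<theta> / 36"
  have "(\<Sum>xy\<in>{1..6} \<times> {1..6}. ss_dice \<theta> ss_set_A ss_set_A xy) = 1"
    "(\<Sum>xy\<in>{1..6} \<times> {1..6}. ss_dice \<theta> ss_set_A ss_set_B xy) = 1"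
    "(\<Sum>xy\<in>{1..6} \<times> {1..6}. ss_dice \<theta> ss_set_A ss_set_C xy) = 1"
    "(\<Sum>xy\<in>{1..6} \<times> {1..6}. ws_dice \<theta> (1, 5, 6, 2) xy) = 1"
    "(\<Sum>xy\<in>{1..6} \<times> {1..6}. ws_dice \<theta> (2, 4, 2, 4) xy) = 1"
    unfolding eq
    by ((simp add: ss_dice_sets[OF ab] ws_dice_sets[OF cd, unfolded One_nat_def]; simp add: ab cd field_simps)+)
  then show ?thesis
    by (cases mdl; cases s) (simp_all del: atLeastAtMost_iff)
qed

definition dice_pmf :: "dice_model \<Rightarrow> real \<Rightarrow> game_state \<Rightarrow> (nat \<times> nat) pmf" where
  "dice_pmf mdl \<theta> s = embed_pmf (dice_mass mdl \<theta> s)"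

lemma pmf_dice_pmf:
  assumes "0 \<le> \<theta>" "\<theta> \<le> 1"
  shows "pmf (dice_pmf mdl \<theta> s) xy = dice_mass mdl \<theta> s xy"
  unfolding dice_pmf_def
proof (rule pmf_embed_pmf)
  show "0 \<le> dice_mass mdl \<theta> s x" for x
    using assms by (rule dice_mass_nonneg)
  have "(\<integral>\<^sup>+ x. ennreal (dice_mass mdl \<theta> s x) \<partial>count_space UNIV)
      = (\<integral>\<^sup>+ x. ennreal (dice_mass mdl \<theta> s x) \<partial>count_space ({1..6} \<times> {1..6}))"
    by (rule nn_integral_count_space_eq) (auto simp: dice_mass_outside)
  also have "\<dots> = ennreal (\<Sum>xy\<in>{1..6} \<times> {1..6}. dice_mass mdl \<theta> s xy)"
    using assms by (simp add: nn_integral_count_space_finite dice_mass_nonneg)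
  finally show "(\<integral>\<^sup>+ x. ennreal (dice_mass mdl \<theta> s x) \<partial>count_space UNIV) = 1"
    by (simp only: dice_mass_sum ennreal_1)
qed

instance game_state :: countable
  by countable_datatype

text \<open>Processes as in \<^const>\<open>hand_rolls\<close> exist: prepare independent rolls for all times and
  states, and use at each time the one for the current state.\<close>

primrec prep_state :: "(nat \<times> game_state \<Rightarrow> nat \<times> nat) \<Rightarrow> nat \<Rightarrow> game_state" where
  "prep_state \<omega> 0 = Come_out"
| "prep_state \<omega> (Suc n) = next_state (prep_state \<omega> n)
     (fst (\<omega> (n, prep_state \<omega> n)) + snd (\<omega> (n, prep_state \<omega> n)))"

lemma prep_state_eq:
  "(\<forall>k<n. \<omega> (k, hand_state r k) = r k) \<Longrightarrow> prep_state \<omega> n = hand_state r n"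
  by (induction n) auto

lemma prep_iff:
  "(\<forall>k<n. \<omega> (k, prep_state \<omega> k) = r k) \<longleftrightarrow> (\<forall>k<n. \<omega> (k, hand_state r k) = r k)"
proof (induction n)
  case (Suc n)
  then show ?case
    using prep_state_eq[of n \<omega> r] by (auto simp: less_Suc_eq)
qed simp

lemma hand_rolls_exist:
  assumes \<theta>: "0 \<le> \<theta>" "\<theta> \<le> 1"
  shows "\<exists>(M :: (nat \<times> game_state \<Rightarrow> nat \<times> nat) measure) R. hand_rolls mdl \<theta> M R"
proof -
  define D where "D = (\<lambda>i :: nat \<times> game_state. measure_pmf (dice_pmf mdl \<theta> (snd i)))"
  define M where "M = PiM UNIV D"
  define R where "R = (\<lambda>n \<omega>. \<omega> (n, prep_state \<omega> n) :: nat \<times> nat)"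
  interpret product_prob_space D UNIV
    unfolding D_def product_prob_space_def product_prob_space_axioms_def product_sigma_finite_def
    by (simp add: prob_space_measure_pmf prob_space_imp_sigma_finite)
  have comp: "(\<lambda>\<omega>. \<omega> i) \<in> measurable M (count_space UNIV)" for i
  proof -
    have "(\<lambda>\<omega>. \<omega> i) \<in> measurable M (D i)"
      unfolding M_def by (rule measurable_component_singleton) simp
    then show ?thesis
      by (simp add: D_def measurable_def)
  qed
  have st: "(\<lambda>\<omega>. prep_state \<omega> n) \<in> measurable M (count_space UNIV)" for n
  proof (induction n)
    case (Suc n)
    have "(\<lambda>\<omega>. \<omega> (n, prep_state \<omega> n)) \<in> measurable M (count_space UNIV)"
      by (rule measurable_compose_countable[OF comp Suc])
    then have "(\<lambda>\<omega>. next_state s (fst (\<omega> (n, prep_state \<omega> n)) + snd (\<omega> (n, prep_state \<omega> n))))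
        \<in> measurable M (count_space UNIV)" for s
      by (rule measurable_compose) simp
    from measurable_compose_countable[OF this Suc] show ?case
      by simp
  qed simp
  have meas: "R n \<in> measurable M (count_space UNIV)" for n
    unfolding R_def by (rule measurable_compose_countable[OF comp st])
  have cyl: "measure M {\<omega> \<in> space M. \<forall>k<n. R k \<omega> = r k}
      = (\<Prod>k<n. dice_mass mdl \<theta> (hand_state r k) (r k))" for n r
  proof -
    define J where "J = (\<lambda>k. (k, hand_state r k)) ` {..<n}"
    have inj: "inj_on (\<lambda>k. (k, hand_state r k)) {..<n}"
      by (auto intro: inj_onI)
    have "{\<omega> \<in> space M. \<forall>k<n. R k \<omega> = r k}
        = {\<omega> \<in> space (PiM UNIV D). \<forall>i\<in>J. \<omega> i \<in> {r (fst i)}}"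
      using prep_iff[of n _ r] by (auto simp: R_def M_def J_def)
    also have "\<dots> = prod_emb UNIV D J (Pi\<^sub>E J (\<lambda>i. {r (fst i)}))"
      by (auto simp: prod_emb_def D_def space_PiM Pi_iff)
    finally have "measure M {\<omega> \<in> space M. \<forall>k<n. R k \<omega> = r k} = (\<Prod>i\<in>J. measure (D i) {r (fst i)})"
      unfolding M_def by (simp only:) (rule measure_PiM_emb, auto simp: J_def D_def)
    also have "\<dots> = (\<Prod>k<n. dice_mass mdl \<theta> (hand_state r k) (r k))"
      unfolding J_def using inj \<theta>
      by (subst prod.reindex) (auto simp: D_def measure_pmf_single pmf_dice_pmf)
    finally show ?thesis .
  qed
  have "hand_rolls mdl \<theta> M R"
    unfolding hand_rolls_def
  proof (intro conjI allI impI)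
    show "prob_space M"
      unfolding M_def by (rule prob_space_axioms)
    show "R n \<in> measurable M (count_space UNIV)" for n
      by (rule meas)
    show "measure M {\<omega> \<in> space M. \<forall>k\<le>n. R k \<omega> = r k} =
        measure M {\<omega> \<in> space M. \<forall>k<n. R k \<omega> = r k} * dice_mass mdl \<theta> (hand_state r n) (r n)"
      for n r
      using cyl[of "Suc n" r] cyl[of n r] by (simp add: less_Suc_eq_le)
  qed
  then show ?thesis
    by blast
qed

end

theory Submission
  imports Defs
begin

text \<open>In both models the chance of a seven-out is the same \<open>1 - K\<close> from every point, and the
  transient part of the transition matrix is an arrow matrix with row sum 1 at coming out. Its
  characteristic polynomial \<open>chi\<close> has sign changes at 0, 1/2, a point \<open>h\<close>, \<open>K\<close> and 1, hence four
  real roots, and its signs at the diagonal entries \<open>d1 \<ge> d2 > d3\<close> show that these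
  interlace the roots. The vectors with components \<open>(z - d1) (z - d2) (z - d3)\<close> and
  \<open>bi (z - dj) (z - dk)\<close> are left eigenvectors at a root \<open>z\<close>; divided by \<open>chi' z\<close> they add up to the
  initial distribution, as divided differences of cubics. This gives
  \<open>P(L > n) = \<Sum> C(z) z ^ n\<close> with
  \<open>C(z) = (1 - K) (z - d1) (z - d2) (z - d3) / ((z - K) chi' z)\<close>, whose signs follow
  from interlacing. The closed forms of the roots come from Ferrari's method together with the
  trigonometric solution of the resolvent cubic, and those of the coefficients from
  \<open>\<Prod> (K - z) = chi K = (K - 1) c1 c2 c3\<close>.\<close>

section \<open>Closed forms for the roots of cubics and quartics\<close>

text \<open>Viete's substitution: \<open>x / (2 * sqrt r)\<close> lies in [1/2, 1], so it is the
  cosine of an angle in [0, pi/3]. The triple angle formula turns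
  \<open>x^3 - 3 * r * x + q = 0\<close> into the value of the cosine of the tripled angle, which is
  still at most pi and hence recovered by \<open>arccos\<close>. The strict inequality excludes the
  triple root 0.\<close>

lemma depressed_cubic_largest_root:
  fixes x y z r q :: real
  assumes xy: "y < x" and xz: "z \<le> x" and sum: "x + y + z = 0"
    and r: "x * y + x * z + y * z = - 3 * r" and q: "x * y * z = - q"
  shows "r > 0" and "x = 2 * sqrt r * cos (1 / 3 * arccos (- q / (2 * r powr (3 / 2))))"
proof -
  have z: "z = - x - y" using sum by simp
  have r3: "3 * r = x^2 + x * y + y^2" using r unfolding z by (simp add: algebra_simps power2_eq_square)
  have x0: "x > 0" using xy xz sum by simp
  have "0 < 3 * x^2 + (x + 2 * y)^2"
    using x0 by (simp add: add_pos_nonneg)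
  then show r0: "r > 0"
    using r3 by (simp add: power2_eq_square algebra_simps)
  define c where "c = x / (2 * sqrt r)"
  have rr: "sqrt r * sqrt r = r" "sqrt r > 0" using r0 by auto
  \<comment> \<open>As the largest root, \<open>x\<close> lies at or beyond the critical point
    \<open>sqrt r\<close> of the cubic.\<close>
  have "r \<le> x^2"
  proof -
    have "0 \<le> (x - y) * (x - z)" using xy xz by simp
    also have "\<dots> = 3 * (x^2 - r)" using r3 unfolding z by (simp add: algebra_simps power2_eq_square)
    finally show ?thesis by simp
  qed
  then have lo: "sqrt r \<le> x" using x0 by (simp add: real_le_lsqrt)
  have "x^2 \<le> 2^2 * r"
  proof -
    have "0 \<le> (x + 2 * y)^2" by simp
    also have "\<dots> = 3 * (2^2 * r - x^2)" using r3 by (simp add: algebra_simps power2_eq_square)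
    finally show ?thesis by simp
  qed
  then have hi: "x \<le> 2 * sqrt r"
    using x0 real_le_rsqrt[of x "2^2 * r"] by (simp add: real_sqrt_mult)
  have c: "1 / 2 \<le> c" "c \<le> 1"
    using lo hi rr by (auto simp: c_def field_simps)
  have phi: "0 \<le> arccos c" "3 * arccos c \<le> pi"
  proof -
    show "0 \<le> arccos c" using c by (simp add: arccos_lbound)
    have "arccos c \<le> arccos (1 / 2)" using c by (intro arccos_le_arccos) auto
    also have "arccos (1 / 2) = pi / 3"
      using arccos_cos[of "pi / 3"] by (simp add: cos_60)
    finally show "3 * arccos c \<le> pi" by simp
  qed
  have rp: "r powr (3 / 2) = r * sqrt r"
  proof -
    have "r powr (3 / 2) = r powr (1 + 1 / 2)" by simp
    also have "\<dots> = r * sqrt r"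
      using r0 by (simp only: powr_add powr_half_sqrt powr_one less_imp_le)
    finally show ?thesis .
  qed
  have "cos (3 * arccos c) = 4 * c^3 - 3 * c"
    using c by (simp add: cos_treble_cos)
  also have "\<dots> = (x^3 - 3 * r * x) / (2 * (r * sqrt r))"
  proof -
    have "c^3 = x^3 / (8 * (r * sqrt r))"
      using rr by (simp add: c_def power_divide power_mult_distrib power3_eq_cube)
    moreover have "c = r * x / (2 * (r * sqrt r))"
      using r0 by (simp add: c_def)
    ultimately show ?thesis
      by (simp add: diff_divide_distrib)
  qed
  also have "x^3 - 3 * r * x = - q"
    using q r3 unfolding z by (simp add: power2_eq_square power3_eq_cube algebra_simps)
  finally have "arccos (- q / (2 * r powr (3 / 2))) = 3 * arccos c"
    using phi unfolding rp by (metis arccos_cos mult_nonneg_nonneg zero_le_numeral)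
  then have "cos (1 / 3 * arccos (- q / (2 * r powr (3 / 2)))) = c"
    using c by simp
  then show "x = 2 * sqrt r * cos (1 / 3 * arccos (- q / (2 * r powr (3 / 2))))"
    using rr by (simp add: c_def)
qed

text \<open>Ferrari's method: \<open>(t + k * \<alpha>) / 3\<close> is the square of \<open>(y1 + y2) / 2\<close>, the largest root
  of the resolvent cubic.\<close>

lemma depressed_quartic_roots:
  fixes y1 y2 y3 y4 t S k r q :: real
  defines "\<alpha> \<equiv> 2 * sqrt r * cos (1 / 3 * arccos (- q / (2 * r powr (3 / 2))))"
  assumes ord: "y1 > y2" "y2 > y3" "y3 > y4" and sum: "y1 + y2 + y3 + y4 = 0"
    and t: "y1*y2 + y1*y3 + y1*y4 + y2*y3 + y2*y4 + y3*y4 = - 2 * t"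
    and S: "y1*y2*y3 + y1*y2*y4 + y1*y3*y4 + y2*y3*y4 = - 4 * S"
    and r: "3 * (y1*y2*y3*y4) = 4 * k^2 * r - t^2" and k: "k > 0"
    and q: "k^3 * q = t^3 - 3 * k^2 * r * t - 27 / 4 * S^2"
  shows "y1 = sqrt ((t + k * \<alpha>) / 3) + sqrt ((2 * t - k * \<alpha>) / 3 - S * sqrt (3 / (t + k * \<alpha>)))"
    and "y2 = sqrt ((t + k * \<alpha>) / 3) - sqrt ((2 * t - k * \<alpha>) / 3 - S * sqrt (3 / (t + k * \<alpha>)))"
    and "y3 = - sqrt ((t + k * \<alpha>) / 3) + sqrt ((2 * t - k * \<alpha>) / 3 + S * sqrt (3 / (t + k * \<alpha>)))"
    and "y4 = - sqrt ((t + k * \<alpha>) / 3) - sqrt ((2 * t - k * \<alpha>) / 3 + S * sqrt (3 / (t + k * \<alpha>)))"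
proof -
  have y4: "y4 = - y1 - y2 - y3" using sum by simp
  have t': "2 * t = y1^2 + y2^2 + y3^2 + y1*y2 + y1*y3 + y2*y3"
    using t unfolding y4 by (simp add: algebra_simps power2_eq_square)
  have S': "4 * S = (y1 + y2) * (y1 + y3) * (y2 + y3)"
    using S unfolding y4 by (simp add: algebra_simps power2_eq_square)
  \<comment> \<open>The squares of the half pair sums are the roots of the resolvent cubic; tripling
    them and subtracting \<open>t\<close> removes its quadratic term.\<close>
  define A B C where "A = 3 * ((y1 + y2) / 2)^2 - t" "B = 3 * ((y1 + y3) / 2)^2 - t"
    "C = 3 * ((y2 + y3) / 2)^2 - t"
  have ABC: "4 * A = 3 * (y1 + y2)^2 - 4 * t" "4 * B = 3 * (y1 + y3)^2 - 4 * t"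
    "4 * C = 3 * (y2 + y3)^2 - 4 * t"
    by (simp_all add: A_B_C_def power_divide)
  have s1: "A + B + C = 0"
    using ABC t' by (simp add: algebra_simps power2_eq_square)
  have s2: "A * B + A * C + B * C = - 3 * (k^2 * r)"
  proof -
    have "16 * (A * B + A * C + B * C) = (4*A) * (4*B) + (4*A) * (4*C) + (4*B) * (4*C)"
      by simp
    also have "\<dots> = - 4 * (3 * (3 * (y1*y2*y3*y4) + t^2))"
      unfolding ABC y4 using t' by Groebner_Basis.algebra
    also have "\<dots> = 16 * (- 3 * (k^2 * r))"
      using r by (simp add: algebra_simps)
    finally show ?thesis by simp
  qed
  have s3: "A * B * C = - (k^3 * q)"
  proof -
    have 1: "A * B * C = 27 / 4 * S^2 - t^3 - t * (A * B + A * C + B * C)"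
    proof -
      have "64 * (A * B * C) = (4*A) * (4*B) * (4*C)" by simp
      also have "\<dots> = 64 * (27 / 4 * S^2) - 64 * t^3 - 4 * t * ((4*A)*(4*B)+(4*A)*(4*C)+(4*B)*(4*C))"
      proof -
        have "64 * (27 / 4 * S^2) = 27 * (4*S)^2" by (simp add: power2_eq_square)
        moreover define U where "U = 4 * t"
        moreover have "U = 2 * (y1^2 + y2^2 + y3^2 + y1*y2 + y1*y3 + y2*y3)"
          using t' by (simp add: U_def)
        moreover have "64 * t^3 = U^3" by (simp add: U_def power3_eq_cube)
        ultimately show ?thesis unfolding ABC S' by Groebner_Basis.algebra
      qed
      finally show ?thesis by (simp add: algebra_simps)
    qed
    show ?thesis unfolding 1 s2 q by (simp add: algebra_simps)
  qed
  \<comment> \<open>Since the roots sum to zero, differences of squared pair sums factor into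
    differences of roots; so the order of the roots makes \<open>A\<close> the largest.\<close>
  have AB: "B < A"
  proof -
    have "0 < (y2 - y3) * (y1 - y4)" using ord by simp
    also have "\<dots> = (y1 + y2)^2 - (y1 + y3)^2"
      unfolding y4 by (simp add: algebra_simps power2_eq_square)
    finally show ?thesis using ABC by simp
  qed
  have AC: "C \<le> A"
  proof -
    have "0 < (y1 - y3) * (y2 - y4)" using ord by simp
    also have "\<dots> = (y1 + y2)^2 - (y2 + y3)^2"
      unfolding y4 by (simp add: algebra_simps power2_eq_square)
    finally show ?thesis using ABC by simp
  qed
  \<comment> \<open>After division by \<open>k\<close> the three numbers are the roots of
    \<open>X^3 - 3 * r * X + q\<close>.\<close>
  have "A / k = \<alpha>"
    unfolding \<alpha>_def
  proof (rule depressed_cubic_largest_root(2)[where y = "B / k" and z = "C / k"])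
    show "A / k + B / k + C / k = 0"
      using s1 by (simp flip: add_divide_distrib)
    have "A / k * (B / k) + A / k * (C / k) + B / k * (C / k) = (A * B + A * C + B * C) / k^2"
      by (simp add: add_divide_distrib power2_eq_square)
    also have "\<dots> = - 3 * r" unfolding s2 using k by simp
    finally show "A / k * (B / k) + A / k * (C / k) + B / k * (C / k) = - 3 * r" .
    have "A / k * (B / k) * (C / k) = A * B * C / k^3" by (simp add: power3_eq_cube)
    also have "\<dots> = - q" unfolding s3 using k by simp
    finally show "A / k * (B / k) * (C / k) = - q" .
  qed (use AB AC k in \<open>auto simp: divide_strict_right_mono divide_right_mono\<close>)
  then have k\<alpha>: "k * \<alpha> = A" using k by auto
  define X where "X = (y1 + y2) / 2"
  have X0: "X > 0" using ord sum by (simp add: X_def)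
  have X2: "(t + k * \<alpha>) / 3 = X^2"
    unfolding k\<alpha> A_B_C_def X_def by simp
  then have sX: "sqrt ((t + k * \<alpha>) / 3) = X" using X0 by simp
  have "3 / (t + k * \<alpha>) = (1 / X)^2"
    using X2 X0 by (simp add: power_divide field_simps)
  then have iX: "sqrt (3 / (t + k * \<alpha>)) = 1 / X" using X0 by simp
  have Y2: "(2 * t - k * \<alpha>) / 3 = t - X^2"
    using X2 by simp
  have SX: "S * (1 / X) = (y1 + y3) * (y2 + y3) / 2"
    using X0 S' by (simp add: X_def field_simps)
  \<comment> \<open>The quartic splits into two quadratics with root sums \<open>2 * X\<close> and
    \<open>- 2 * X\<close>; these are the quarters of their discriminants.\<close>
  have "t - X^2 - S * (1 / X) = ((y1 - y2) / 2)^2" 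
    "t - X^2 + S * (1 / X) = ((y3 - y4) / 2)^2"
    unfolding SX using t' unfolding X_def y4 by (simp_all add: field_simps power2_eq_square)
  then have "sqrt (t - X^2 - S * (1 / X)) = (y1 - y2) / 2" "sqrt (t - X^2 + S * (1 / X)) = (y3 - y4) / 2"
    using ord by simp_all
  then show "y1 = sqrt ((t + k * \<alpha>) / 3) + sqrt ((2 * t - k * \<alpha>) / 3 - S * sqrt (3 / (t + k * \<alpha>)))"
    "y2 = sqrt ((t + k * \<alpha>) / 3) - sqrt ((2 * t - k * \<alpha>) / 3 - S * sqrt (3 / (t + k * \<alpha>)))"
    "y3 = - sqrt ((t + k * \<alpha>) / 3) + sqrt ((2 * t - k * \<alpha>) / 3 + S * sqrt (3 / (t + k * \<alpha>)))"
    "y4 = - sqrt ((t + k * \<alpha>) / 3) - sqrt ((2 * t - k * \<alpha>) / 3 + S * sqrt (3 / (t + k * \<alpha>)))"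
    unfolding sX iX Y2 by (simp_all add: X_def y4 field_simps)
qed

section \<open>Vieta's relations and divided differences\<close>

text \<open>The iterated divided differences of the quartic at distinct roots vanish, since a factor
  such as \<open>x - y\<close> can be cancelled in an integral domain. The third one gives
  \<open>p\<close>; the other coefficients follow by back substitution.\<close>

lemma monic_quartic_vieta:
  fixes p q r s x1 x2 x3 x4 :: "'a :: idom"
  assumes root: "\<And>x. x \<in> {x1, x2, x3, x4} \<Longrightarrow> x^4 + p * x^3 + q * x^2 + r * x + s = 0"
    and dist: "distinct [x1, x2, x3, x4]"
  shows "p = - (x1 + x2 + x3 + x4)"
    and "q = x1*x2 + x1*x3 + x1*x4 + x2*x3 + x2*x4 + x3*x4"
    and "r = - (x1*x2*x3 + x1*x2*x4 + x1*x3*x4 + x2*x3*x4)"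
    and "s = x1*x2*x3*x4"
proof -
  have d2: "x^3 + x^2*y + x*y^2 + y^3 + p * (x^2 + x*y + y^2) + q * (x + y) + r = 0"
    if "x \<noteq> y" "x \<in> {x1, x2, x3, x4}" "y \<in> {x1, x2, x3, x4}" for x y
  proof -
    have "(x - y) * (x^3 + x^2*y + x*y^2 + y^3 + p * (x^2 + x*y + y^2) + q * (x + y) + r) = 0"
      using root[OF that(2)] root[OF that(3)] by Groebner_Basis.algebra
    then show ?thesis using that(1) by simp
  qed
  have x12: "x1 \<noteq> x2" and x34: "x3 \<noteq> x4" using dist by auto
  have d3: "x1^2 + y^2 + x2^2 + x1*y + x1*x2 + y*x2 + p * (x1 + x2 + y) + q = 0"
    if y: "y = x3 \<or> y = x4" for y
  proof -
    have ne: "x1 \<noteq> y" "y \<noteq> x2" using y dist by auto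
    have "(x1 - y) * (x1^2 + y^2 + x2^2 + x1*y + x1*x2 + y*x2 + p * (x1 + x2 + y) + q) = 0"
      using d2[OF x12] d2[OF ne(2)] y by simp Groebner_Basis.algebra
    then show ?thesis using ne by simp
  qed
  note e3 = d3[OF disjI1[OF refl]] and e4 = d3[OF disjI2[OF refl]]
  have "(x3 - x4) * (x1 + x2 + x3 + x4 + p) = 0"
    using e3 e4 by Groebner_Basis.algebra
  then have "x1 + x2 + x3 + x4 + p = 0"
    using x34 by simp
  then show p: "p = - (x1 + x2 + x3 + x4)"
    by Groebner_Basis.algebra
  then show q: "q = x1*x2 + x1*x3 + x1*x4 + x2*x3 + x2*x4 + x3*x4"
    using e3 by Groebner_Basis.algebra
  have "x1^3 + x1^2*x2 + x1*x2^2 + x2^3 + p * (x1^2 + x1*x2 + x2^2) + q * (x1 + x2) + r = 0"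
    using d2[OF x12] by simp
  then show r: "r = - (x1*x2*x3 + x1*x2*x4 + x1*x3*x4 + x2*x3*x4)"
    unfolding p q by Groebner_Basis.algebra
  have "x1^4 + p * x1^3 + q * x1^2 + r * x1 + s = 0"
    using root by simp
  then show "s = x1*x2*x3*x4"
    unfolding p q r by Groebner_Basis.algebra
qed

text \<open>The sum is the third divided difference, which extracts the leading coefficient of a
  cubic. Over the Vandermonde product as common denominator the signs alternate, because the factors
  are written in cyclic order.\<close>

lemma divided_difference_cubic:
  fixes x1 x2 x3 x4 :: "'a :: field"
  assumes dist: "distinct [x1, x2, x3, x4]"
    and f: "\<And>x. f x = p0 + p1 * x + p2 * x^2 + p3 * x^3"
  shows "f x1 / ((x1 - x2) * (x1 - x3) * (x1 - x4)) + f x2 / ((x2 - x3) * (x2 - x4) * (x2 - x1))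
       + f x3 / ((x3 - x4) * (x3 - x1) * (x3 - x2)) + f x4 / ((x4 - x1) * (x4 - x2) * (x4 - x3)) = p3"
proof -
  define V where "V = (x1 - x2) * (x1 - x3) * (x1 - x4) * (x2 - x3) * (x2 - x4) * (x3 - x4)"
  have V: "V \<noteq> 0" using dist by (simp add: V_def)
  have n: "(x1 - x2) * (x1 - x3) * (x1 - x4) \<noteq> 0" "(x2 - x3) * (x2 - x4) * (x2 - x1) \<noteq> 0"
    "(x3 - x4) * (x3 - x1) * (x3 - x2) \<noteq> 0" "(x4 - x1) * (x4 - x2) * (x4 - x3) \<noteq> 0"
    using dist by auto
  have E: "f x1 / ((x1 - x2) * (x1 - x3) * (x1 - x4)) = f x1 * ((x2 - x3) * (x2 - x4) * (x3 - x4)) / V"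
    "f x2 / ((x2 - x3) * (x2 - x4) * (x2 - x1)) = - (f x2 * ((x1 - x3) * (x1 - x4) * (x3 - x4))) / V"
    "f x3 / ((x3 - x4) * (x3 - x1) * (x3 - x2)) = f x3 * ((x1 - x2) * (x1 - x4) * (x2 - x4)) / V"
    "f x4 / ((x4 - x1) * (x4 - x2) * (x4 - x3)) = - (f x4 * ((x1 - x2) * (x1 - x3) * (x2 - x3))) / V"
    unfolding n[THEN frac_eq_eq, OF V] unfolding V_def by Groebner_Basis.algebra+
  have sum: "A / V + - B / V + C / V + - D / V = (A - B + C - D) / V" for A B C D
    by (simp add: add_divide_distrib diff_divide_distrib)
  have "f x1 * ((x2 - x3) * (x2 - x4) * (x3 - x4)) - f x2 * ((x1 - x3) * (x1 - x4) * (x3 - x4))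
      + f x3 * ((x1 - x2) * (x1 - x4) * (x2 - x4)) - f x4 * ((x1 - x2) * (x1 - x3) * (x2 - x3)) = p3 * V"
    unfolding f V_def by Groebner_Basis.algebra
  then show ?thesis
    unfolding E sum using V by simp
qed

section \<open>The arrow matrix: characteristic polynomial, interlacing, survival
  probabilities\<close>

text \<open>The transition matrix restricted to coming out and the three classes of points is an arrow
  matrix: outside the first row, the first column and the diagonal it vanishes. \<open>K\<close> is the
  probability not to seven out from a point, and \<open>h\<close> will separate the second eigenvalue from
  the third, which is needed when \<open>d1 = d2\<close>.\<close>

locale arrow_chain =
  fixes a b1 b2 b3 c1 c2 c3 d1 d2 d3 K h :: real
  assumes row: "a + b1 + b2 + b3 = 1"
    and K: "c1 = K - d1" "c2 = K - d2" "c3 = K - d3" "K < 1"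
    and pos: "b1 > 0" "b2 > 0" "b3 > 0" "c1 > 0" "c2 > 0" "c3 > 0"
    and d: "d3 < d2" "d2 \<le> d1"
    and h: "1 / 2 < d3" "1 / 2 < h" "h < d1"
begin

text \<open>The expanded determinant of \<open>z\<close> times the identity minus the transient
  block. It is polymorphic so that it serves both the sign analysis over the reals and the complex
  eigenvalues.\<close>

definition chi :: "'a :: real_algebra_1 \<Rightarrow> 'a" where
  "chi z = (z - of_real a) * (z - of_real d1) * (z - of_real d2) * (z - of_real d3)
     - of_real (b1 * c1) * (z - of_real d2) * (z - of_real d3)
     - of_real (b2 * c2) * (z - of_real d1) * (z - of_real d3)
     - of_real (b3 * c3) * (z - of_real d1) * (z - of_real d2)"

lemma chi_real:
  "chi (z :: real) = (z - a) * (z - d1) * (z - d2) * (z - d3)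
     - b1 * c1 * (z - d2) * (z - d3) - b2 * c2 * (z - d1) * (z - d3) - b3 * c3 * (z - d1) * (z - d2)"
  by (simp add: chi_def)

lemma K_bounds: "d1 < K" "d2 < K" "d3 < K"
  using K pos by auto

text \<open>At \<open>K\<close> every factor \<open>K - di\<close> is \<open>ci\<close>, so all four
  summands are multiples of \<open>c1 * c2 * c3\<close>.\<close>

lemma chi_K: "chi K = (K - 1) * (c1 * c2 * c3)"
proof -
  have a: "a = 1 - b1 - b2 - b3" using row by simp
  show ?thesis unfolding chi_real unfolding K a by Groebner_Basis.algebra
qed

lemma chi_K_neg: "chi K < 0"
  unfolding chi_K using K pos by (simp add: mult_neg_pos)

lemma chi_1_pos: "chi (1 :: real) > 0"
proof -
  have a: "a = 1 - b1 - b2 - b3" using row by simp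
  \<comment> \<open>With \<open>1 - a\<close> replaced by \<open>b1 + b2 + b3\<close>, the terms
    regroup into multiples of \<open>1 - di - ci = 1 - K\<close>.\<close>
  have "chi (1 :: real) = (1 - K) * (b1 * (1 - d2) * (1 - d3) + b2 * (1 - d1) * (1 - d3) + b3 * (1 - d1) * (1 - d2))"
    unfolding chi_real unfolding K a by Groebner_Basis.algebra
  also have "\<dots> > 0"
    using K pos K_bounds by (intro mult_pos_pos add_pos_pos) auto
  finally show ?thesis .
qed

lemma chi_d:
  "chi d1 = - (b1 * c1 * (d1 - d2) * (d1 - d3))"
  "chi d2 = b2 * c2 * (d1 - d2) * (d2 - d3)"
  "chi d3 = - (b3 * c3 * (d1 - d3) * (d2 - d3))"
  unfolding chi_real by Groebner_Basis.algebra+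

lemma chi_root_exists:
  assumes "x < y" "chi x * chi y < (0 :: real)"
  shows "\<exists>z. x < z \<and> z < y \<and> chi z = 0"
proof -
  have cont: "continuous_on {x..y} (chi :: real \<Rightarrow> real)"
    unfolding chi_def by (intro continuous_intros)
  have ne: "chi x \<noteq> 0" "chi y \<noteq> 0" using assms(2) by auto
  have "\<exists>z. x \<le> z \<and> z \<le> y \<and> chi z = 0"
  proof (cases "chi x < 0")
    case True
    then have "chi y > 0" using assms(2) by (simp add: mult_less_0_iff)
    then show ?thesis using IVT'[of chi x 0 y] True cont assms(1) by auto
  next
    case False
    then have "chi x > 0" "chi y < 0" using assms(2) by (auto simp: mult_less_0_iff)
    then show ?thesis using IVT2'[of chi y 0 x] cont assms(1) by auto
  qed
  then show ?thesis using ne by (metis order_le_less)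
qed

end

text \<open>Taking the roots as parameters, located only by separating points, lets the analysis go
  ahead before their closed forms are known.\<close>

locale arrow_chain_roots = arrow_chain +
  fixes x1 x2 x3 x4 :: real
  assumes roots: "chi x1 = 0" "chi x2 = 0" "chi x3 = 0" "chi x4 = 0"
    and x: "0 < x4" "x4 < 1 / 2" "1 / 2 < x3" "x3 < h" "h < x2" "x2 < K" "K < x1" "x1 < 1"
begin

lemma x_order: "x4 < x3" "x3 < x2" "x2 < x1"
  using x by auto

lemma vieta:
  "x1 + x2 + x3 + x4 = a + d1 + d2 + d3"
  "x1*x2 + x1*x3 + x1*x4 + x2*x3 + x2*x4 + x3*x4
     = a*d1 + a*d2 + a*d3 + d1*d2 + d1*d3 + d2*d3 - b1*c1 - b2*c2 - b3*c3"
  "x1*x2*x3 + x1*x2*x4 + x1*x3*x4 + x2*x3*x4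
     = a*d1*d2 + a*d1*d3 + a*d2*d3 + d1*d2*d3
       - b1*c1*(d2 + d3) - b2*c2*(d1 + d3) - b3*c3*(d1 + d2)"
  "x1*x2*x3*x4 = a*d1*d2*d3 - b1*c1*d2*d3 - b2*c2*d1*d3 - b3*c3*d1*d2"
proof -
  have dist: "distinct [x1, x2, x3, x4]" using x_order by auto
  have "z^4 + (- (a + d1 + d2 + d3)) * z^3
     + (a*d1 + a*d2 + a*d3 + d1*d2 + d1*d3 + d2*d3 - b1*c1 - b2*c2 - b3*c3) * z^2
     + (- (a*d1*d2 + a*d1*d3 + a*d2*d3 + d1*d2*d3
       - b1*c1*(d2 + d3) - b2*c2*(d1 + d3) - b3*c3*(d1 + d2))) * z
     + (a*d1*d2*d3 - b1*c1*d2*d3 - b2*c2*d1*d3 - b3*c3*d1*d2) = chi z" for z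
    unfolding chi_real by Groebner_Basis.algebra
  then have "z^4 + (- (a + d1 + d2 + d3)) * z^3
     + (a*d1 + a*d2 + a*d3 + d1*d2 + d1*d3 + d2*d3 - b1*c1 - b2*c2 - b3*c3) * z^2
     + (- (a*d1*d2 + a*d1*d3 + a*d2*d3 + d1*d2*d3
       - b1*c1*(d2 + d3) - b2*c2*(d1 + d3) - b3*c3*(d1 + d2))) * z
     + (a*d1*d2*d3 - b1*c1*d2*d3 - b2*c2*d1*d3 - b3*c3*d1*d2) = 0" if "z \<in> {x1, x2, x3, x4}" for z
    using that roots by auto
  from monic_quartic_vieta[OF this dist]
  show "x1 + x2 + x3 + x4 = a + d1 + d2 + d3"
  "x1*x2 + x1*x3 + x1*x4 + x2*x3 + x2*x4 + x3*x4
     = a*d1 + a*d2 + a*d3 + d1*d2 + d1*d3 + d2*d3 - b1*c1 - b2*c2 - b3*c3"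
  "x1*x2*x3 + x1*x2*x4 + x1*x3*x4 + x2*x3*x4
     = a*d1*d2 + a*d1*d3 + a*d2*d3 + d1*d2*d3
       - b1*c1*(d2 + d3) - b2*c2*(d1 + d3) - b3*c3*(d1 + d2)"
  "x1*x2*x3*x4 = a*d1*d2*d3 - b1*c1*d2*d3 - b2*c2*d1*d3 - b3*c3*d1*d2"
    by simp_all
qed

text \<open>Vieta's relations are carried along \<open>of_real\<close>, so the factorization holds
  over the complex numbers too and rules out any further complex root.\<close>

lemma chi_factor:
  "chi z = (z - of_real x1) * (z - of_real x2) * (z - of_real x3) * (z - (of_real x4 :: 'a :: real_field))"
proof -
  note v = vieta[THEN arg_cong[where f = "of_real :: real \<Rightarrow> 'a"],
      unfolded of_real_add of_real_mult of_real_diff]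
  show ?thesis
    unfolding chi_def of_real_mult using v by Groebner_Basis.algebra
qed

text \<open>At \<open>d1\<close> and \<open>d2\<close> the sign of \<open>chi\<close> is only weak,
  as the factor \<open>d1 - d2\<close> may vanish; hence the weak bounds on \<open>x2\<close> in
  general and the strict ones for \<open>d2 < d1\<close>.\<close>

lemma interlacing: "x4 < d3" "d3 < x3" "x3 < d2" "d2 \<le> x2" "x2 \<le> d1" "d2 < d1 \<Longrightarrow> d2 < x2 \<and> x2 < d1"
proof -
  have f: "chi z = (z - x1) * (z - x2) * (z - x3) * (z - x4)" for z :: real
    using chi_factor[of z] by simp
  have half: "x4 < d1" "x4 < d2" "x4 < d3" using h x d by auto
  have x1: "d1 < x1" "d2 < x1" "d3 < x1" using K_bounds x by auto
  have d1: "x3 < d1" using h x by auto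
  have "chi d1 = - ((x1 - d1) * (d1 - x3) * (d1 - x4)) * (d1 - x2)"
    unfolding f by Groebner_Basis.algebra
  moreover have p1: "0 < (x1 - d1) * (d1 - x3) * (d1 - x4)"
    using x1 d1 half by simp
  moreover have "chi d1 \<le> 0" unfolding chi_d using pos d by simp
  ultimately show A: "x2 \<le> d1"
    by (smt (verit, ccfv_SIG) mult_neg_neg mult_minus_left mult_neg_pos)
  show "x4 < d3" by fact
  have p2: "0 < (x1 - d2) * (d2 - x4)" using half x1 by simp
  have e2: "chi d2 = (x1 - d2) * (d2 - x4) * ((x2 - d2) * (d2 - x3))"
    unfolding f by Groebner_Basis.algebra
  have "chi d2 \<ge> 0" unfolding chi_d using pos d by simp
  \<comment> \<open>The other two factors being positive, \<open>d2\<close> must lie between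
    \<open>x3\<close> and \<open>x2\<close>; \<open>x2 < d2\<close> would make both factors here
    have opposite signs.\<close>
  then have q2: "(x2 - d2) * (d2 - x3) \<ge> 0"
    using p2 unfolding e2 by (simp add: zero_le_mult_iff)
  then show B: "d2 \<le> x2"
    using x_order by (simp add: zero_le_mult_iff) auto
  have str: "x2 < d1 \<and> d2 < x2 \<and> x3 < d2" if "d2 < d1"
  proof -
    have "chi d1 < 0" "chi d2 > 0" unfolding chi_d using pos d that by simp_all
    then have "chi d1 \<noteq> 0" "chi d2 \<noteq> 0" by auto
    then have "x2 \<noteq> d1" "d2 \<noteq> x2" "x3 \<noteq> d2" unfolding f by auto
    moreover have "x3 \<le> d2" using q2 x_order by (simp add: zero_le_mult_iff) auto
    ultimately show ?thesis using A B by auto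
  qed
  then show "d2 < d1 \<Longrightarrow> d2 < x2 \<and> x2 < d1" by simp
  \<comment> \<open>If \<open>d1 = d2\<close>, the two weak bounds force \<open>x2\<close> to that
    value, and \<open>h\<close> separates \<open>x3\<close> from it.\<close>
  show "x3 < d2" using str A B d x by fastforce
  have "chi d3 < 0" unfolding chi_d using pos d by simp
  moreover have "chi d3 = - ((x1 - d3) * (x2 - d3) * (d3 - x4)) * (x3 - d3)"
    unfolding f by Groebner_Basis.algebra
  moreover have "0 < (x1 - d3) * (x2 - d3) * (d3 - x4)" using x1 half B d by simp
  ultimately show "d3 < x3" by (simp add: zero_less_mult_iff)
qed

text \<open>The weight of the root \<open>e\<close> in the survival probability: when the arguments
  are the four roots, the triple product in the denominator is the derivative of \<open>chi\<close>
  at \<open>e\<close>.\<close>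

definition coeff :: "real \<Rightarrow> real \<Rightarrow> real \<Rightarrow> real \<Rightarrow> real" where
  "coeff e f g i = (1 - K) * ((e - d1) * (e - d2) * (e - d3)) / ((e - K) * ((e - f) * (e - g) * (e - i)))"

lemma coeff_signs:
  "coeff x1 x2 x3 x4 > 0"
  "d2 < d1 \<Longrightarrow> coeff x2 x3 x4 x1 < 0"
  "d2 = d1 \<Longrightarrow> coeff x2 x3 x4 x1 = 0"
  "coeff x3 x4 x1 x2 < 0"
  "coeff x4 x1 x2 x3 < 0"
proof -
  note I = interlacing K_bounds x x_order K d
  show "coeff x1 x2 x3 x4 > 0"
    unfolding coeff_def using I by (intro divide_pos_pos mult_pos_pos) auto
  show "coeff x2 x3 x4 x1 < 0" if "d2 < d1"
  proof -
    have "(1 - K) * ((x2 - d1) * (x2 - d2) * (x2 - d3)) < 0"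
      using I that by (intro mult_pos_neg mult_neg_pos) auto
    moreover have "(x2 - K) * ((x2 - x3) * (x2 - x4) * (x2 - x1)) > 0"
      using I by (intro mult_neg_neg mult_pos_neg mult_pos_pos) auto
    ultimately show ?thesis unfolding coeff_def by (rule divide_neg_pos)
  qed
  \<comment> \<open>Interlacing gives \<open>x2 = d1\<close> here, so the numerator has a zero
    factor.\<close>
  show "coeff x2 x3 x4 x1 = 0" if "d2 = d1"
    unfolding coeff_def using I that by auto
  show "coeff x3 x4 x1 x2 < 0"
  proof -
    have "(1 - K) * ((x3 - d1) * (x3 - d2) * (x3 - d3)) > 0"
      using I by (intro mult_pos_pos mult_neg_neg) auto
    moreover have "(x3 - K) * ((x3 - x4) * (x3 - x1) * (x3 - x2)) < 0"
      using I by (intro mult_neg_pos mult_neg_neg mult_pos_neg) auto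
    ultimately show ?thesis unfolding coeff_def by (rule divide_pos_neg)
  qed
  show "coeff x4 x1 x2 x3 < 0"
  proof -
    have "(1 - K) * ((x4 - d1) * (x4 - d2) * (x4 - d3)) < 0"
      using I by (intro mult_pos_neg mult_neg_neg mult_pos_neg) auto
    moreover have "(x4 - K) * ((x4 - x1) * (x4 - x2) * (x4 - x3)) > 0"
      using I by (intro mult_neg_neg mult_pos_neg) auto
    ultimately show ?thesis unfolding coeff_def by (rule divide_neg_pos)
  qed
qed

text \<open>Evaluating the factored \<open>chi\<close> at \<open>K\<close> trades
  \<open>e - K\<close> for the other three roots, which is the shape of the closed formulas.
  Allowing any permutation of the roots covers all four cyclic shifts at once.\<close>

lemma coeff_eq_product:
  assumes "{e, f, g, i} = {x1, x2, x3, x4}" "distinct [e, f, g, i]"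
  shows "coeff e f g i = (d1 - e) * (d2 - e) * (d3 - e) * ((K - f) * (K - g) * (K - i))
    / (c1 * c2 * c3 * ((f - e) * (g - e) * (i - e)))"
proof -
  have "(K - e) * ((K - f) * (K - g) * (K - i)) = prod (\<lambda>y. K - y) {e, f, g, i}"
    using assms(2) by simp
  also have "\<dots> = chi K"
    unfolding assms(1) chi_factor using x_order by simp
  finally have *: "(K - e) * ((K - f) * (K - g) * (K - i)) = (K - 1) * (c1 * c2 * c3)"
    unfolding chi_K .
  have Ke: "K \<noteq> e"
    using * chi_K chi_K_neg by auto
  have c: "c1 * c2 * c3 \<noteq> 0" using pos by simp
  have P: "(K - f) * (K - g) * (K - i) = (1 - K) * (c1 * c2 * c3) / (e - K)"
    using * Ke by (simp add: eq_divide_eq) Groebner_Basis.algebra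
  have minus: "(d1 - e) * (d2 - e) * (d3 - e) = - ((e - d1) * (e - d2) * (e - d3))"
    "(f - e) * (g - e) * (i - e) = - ((e - f) * (e - g) * (e - i))"
    by Groebner_Basis.algebra+
  show ?thesis
    unfolding coeff_def P minus using c by (simp add: mult_ac)
qed

lemma survival:
  assumes init: "v0 0 = 1" "v1 0 = 0" "v2 0 = 0" "v3 0 = 0"
    and step: "\<And>n. v0 (Suc n) = a * v0 n + c1 * v1 n + c2 * v2 n + c3 * v3 n"
      "\<And>n. v1 (Suc n) = b1 * v0 n + d1 * v1 n"
      "\<And>n. v2 (Suc n) = b2 * v0 n + d2 * v2 n"
      "\<And>n. v3 (Suc n) = b3 * v0 n + d3 * v3 n"
  shows "v0 n + v1 n + v2 n + v3 n = coeff x1 x2 x3 x4 * x1 ^ n + coeff x2 x3 x4 x1 * x2 ^ n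
     + coeff x3 x4 x1 x2 * x3 ^ n + coeff x4 x1 x2 x3 * x4 ^ n"
proof -
  have dist: "distinct [x1, x2, x3, x4]" using x_order by auto
  \<comment> \<open>\<open>w p n\<close> is the third divided difference of
    \<open>p z * z ^ n\<close> at the roots. It is linear in \<open>p\<close>, sees \<open>p\<close>
    only at the roots, and a step in \<open>n\<close> is a multiplication of \<open>p\<close> by
    \<open>z\<close>.\<close>
  define w where "w = (\<lambda>p n. p x1 / ((x1 - x2) * (x1 - x3) * (x1 - x4)) * x1 ^ n
     + p x2 / ((x2 - x3) * (x2 - x4) * (x2 - x1)) * x2 ^ n
     + p x3 / ((x3 - x4) * (x3 - x1) * (x3 - x2)) * x3 ^ n
     + p x4 / ((x4 - x1) * (x4 - x2) * (x4 - x3)) * x4 ^ n)"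
  define p0 p1 p2 p3 where p: "p0 = (\<lambda>z. (z - d1) * (z - d2) * (z - d3))"
    "p1 = (\<lambda>z. b1 * ((z - d2) * (z - d3)))" "p2 = (\<lambda>z. b2 * ((z - d1) * (z - d3)))"
    "p3 = (\<lambda>z. b3 * ((z - d1) * (z - d2)))"
  have w_add: "w (\<lambda>z. f z + g z) n = w f n + w g n" for f g n
    unfolding w_def by (simp add: add_divide_distrib algebra_simps)
  have w_mult: "w (\<lambda>z. r * f z) n = r * w f n" for r f n
    unfolding w_def by (simp add: algebra_simps)
  have w_Suc: "w f (Suc n) = w (\<lambda>z. z * f z) n" for f n
    unfolding w_def by (simp add: mult_ac)
  have w_cong: "w f n = w g n" if "\<And>z. chi z = 0 \<Longrightarrow> f z = g z" for f g n
    unfolding w_def by (simp add: roots that)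
  \<comment> \<open>Only the leading coefficient of a cubic survives at time 0, so the monic
    \<open>p0\<close> starts with mass 1 and the quadratic \<open>p1\<close>, \<open>p2\<close>,
    \<open>p3\<close> with mass 0.\<close>
  have w_0: "w f 0 = D" if "\<And>z. f z = A + B * z + C * z^2 + D * z^3" for f A B C D
    unfolding w_def using divided_difference_cubic[OF dist that] by simp
  have "v0 n = w p0 n \<and> v1 n = w p1 n \<and> v2 n = w p2 n \<and> v3 n = w p3 n"
  proof (induction n)
    case 0
    have "w p0 0 = 1"
      by (rule w_0[of _ "- d1 * d2 * d3" "d1 * d2 + d1 * d3 + d2 * d3" "- (d1 + d2 + d3)"])
        (unfold p, Groebner_Basis.algebra)
    moreover have "w p1 0 = 0"
      by (rule w_0[of _ "b1 * d2 * d3" "- b1 * (d2 + d3)" b1]) (unfold p, Groebner_Basis.algebra)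
    moreover have "w p2 0 = 0"
      by (rule w_0[of _ "b2 * d1 * d3" "- b2 * (d1 + d3)" b2]) (unfold p, Groebner_Basis.algebra)
    moreover have "w p3 0 = 0"
      by (rule w_0[of _ "b3 * d1 * d2" "- b3 * (d1 + d2)" b3]) (unfold p, Groebner_Basis.algebra)
    ultimately show ?case by (simp add: init)
  next
    case (Suc n)
    \<comment> \<open>The first eigenvector equation is \<open>chi z = 0\<close>; the other three
      are identities in \<open>z\<close>.\<close>
    have "w p0 (Suc n) = w (\<lambda>z. a * p0 z + c1 * p1 z + c2 * p2 z + c3 * p3 z) n"
      unfolding w_Suc by (rule w_cong) (unfold chi_real p, Groebner_Basis.algebra)
    moreover have "w p1 (Suc n) = w (\<lambda>z. b1 * p0 z + d1 * p1 z) n"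
      unfolding w_Suc by (rule w_cong) (simp add: p algebra_simps)
    moreover have "w p2 (Suc n) = w (\<lambda>z. b2 * p0 z + d2 * p2 z) n"
      unfolding w_Suc by (rule w_cong) (simp add: p algebra_simps)
    moreover have "w p3 (Suc n) = w (\<lambda>z. b3 * p0 z + d3 * p3 z) n"
      unfolding w_Suc by (rule w_cong) (simp add: p algebra_simps)
    ultimately show ?case
      using Suc.IH by (simp add: step w_add w_mult)
  qed
  then have "v0 n + v1 n + v2 n + v3 n = w (\<lambda>z. p0 z + p1 z + p2 z + p3 z) n"
    by (simp add: w_add)
  \<comment> \<open>The rows of the transient block sum to 1 and three times to \<open>K\<close>.
    Adding the eigenvector equations thus gives \<open>z * (p0 z + p1 z + p2 z + p3 z) = p0 z + K *
    (p1 z + p2 z + p3 z)\<close>.\<close>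
  also have "\<dots> = w (\<lambda>z. (1 - K) * p0 z / (z - K)) n"
  proof (rule w_cong)
    fix z :: real assume z: "chi z = 0"
    then have "z \<noteq> K" using chi_K_neg by auto
    moreover have "(p0 z + p1 z + p2 z + p3 z) * (z - K) = (1 - K) * p0 z"
    proof -
      have "a = 1 - b1 - b2 - b3" using row by simp
      then show ?thesis using z unfolding chi_real p unfolding K by Groebner_Basis.algebra
    qed
    ultimately show "p0 z + p1 z + p2 z + p3 z = (1 - K) * p0 z / (z - K)"
      by (simp add: eq_divide_eq)
  qed
  also have "\<dots> = coeff x1 x2 x3 x4 * x1 ^ n + coeff x2 x3 x4 x1 * x2 ^ n
     + coeff x3 x4 x1 x2 * x3 ^ n + coeff x4 x1 x2 x3 * x4 ^ n"
    unfolding w_def coeff_def p by (simp add: mult_ac)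
  finally show ?thesis .
qed

text \<open>These are the survival probabilities at times 0 and 1. The second is 1 because a
  come-out roll never ends the hand.\<close>

lemma coeff_sum:
  "coeff x1 x2 x3 x4 + coeff x2 x3 x4 x1 + coeff x3 x4 x1 x2 + coeff x4 x1 x2 x3 = 1"
  "coeff x1 x2 x3 x4 * x1 + coeff x2 x3 x4 x1 * x2 + coeff x3 x4 x1 x2 * x3 + coeff x4 x1 x2 x3 * x4 = 1"
proof -
  \<comment> \<open>Iterating the recurrence from coming out yields sequences for
    \<open>survival\<close> without any random process.\<close>
  define v :: "nat \<Rightarrow> real \<times> real \<times> real \<times> real" where
    "v n = ((\<lambda>(p, q, r, s). (a * p + c1 * q + c2 * r + c3 * s, b1 * p + d1 * q, b2 * p + d2 * r, b3 * p + d3 * s)) ^^ n)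
      (1, 0, 0, 0)" for n
  note S = survival[where ?v0.0 = "\<lambda>n. fst (v n)" and ?v1.0 = "\<lambda>n. fst (snd (v n))"
      and ?v2.0 = "\<lambda>n. fst (snd (snd (v n)))" and ?v3.0 = "\<lambda>n. snd (snd (snd (v n)))"]
  show "coeff x1 x2 x3 x4 + coeff x2 x3 x4 x1 + coeff x3 x4 x1 x2 + coeff x4 x1 x2 x3 = 1"
    using S[where n = 0] by (simp add: v_def split_beta)
  show "coeff x1 x2 x3 x4 * x1 + coeff x2 x3 x4 x1 * x2 + coeff x3 x4 x1 x2 * x3 + coeff x4 x1 x2 x3 * x4 = 1"
    using S[where n = 1] row by (simp add: v_def split_beta)
qed

end

lemma (in arrow_chain) roots_exist:
  assumes "chi (0 :: real) > 0" "chi (1 / 2 :: real) < 0" "chi h > 0"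
  obtains x1 x2 x3 x4 where "arrow_chain_roots a b1 b2 b3 c1 c2 c3 d1 d2 d3 K h x1 x2 x3 x4"
proof -
  have "h < K" using h K_bounds by simp
  have "chi 0 * chi (1 / 2) < (0 :: real)" "chi (1 / 2) * chi h < 0" "chi h * chi K < 0"
    "chi K * chi 1 < 0"
    using assms chi_K_neg chi_1_pos by (auto intro: mult_pos_neg mult_neg_pos)
  then obtain x1 x2 x3 x4 :: real where "0 < x4" "x4 < 1 / 2" "chi x4 = 0"
    "1 / 2 < x3" "x3 < h" "chi x3 = 0" "h < x2" "x2 < K" "chi x2 = 0" "K < x1" "x1 < 1" "chi x1 = 0"
    using chi_root_exists[of 0 "1 / 2"] chi_root_exists[of "1 / 2" h] chi_root_exists[of h K]
      chi_root_exists[of K 1] \<open>h < K\<close> h K by auto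
  then have "arrow_chain_roots a b1 b2 b3 c1 c2 c3 d1 d2 d3 K h x1 x2 x3 x4"
    by unfold_locales
  then show ?thesis by (rule that)
qed

section \<open>Eigenvalues of the full transition matrix\<close>

lemma less_5_cases: "i < 5 \<Longrightarrow> i = 0 \<or> i = 1 \<or> i = 2 \<or> i = 3 \<or> i = (4 :: nat)"
  by auto

context arrow_chain
begin

definition chain_mat :: "real mat" where
  "chain_mat = mat_of_rows_list 5
    [[a, b1, b2, b3, 0], [c1, d1, 0, 0, 1 - K], [c2, 0, d2, 0, 1 - K], [c3, 0, 0, d3, 1 - K], [0, 0, 0, 0, 1]]"

lemma dim_chain_mat: "dim_row chain_mat = 5" "dim_col chain_mat = 5"
  by (simp_all add: chain_mat_def mat_of_rows_list_def)

lemma eigenvector_chain_mat_iff: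
  fixes v :: "complex vec"
  assumes v: "v \<in> carrier_vec 5"
  shows "eigenvector (map_mat complex_of_real chain_mat) v z \<longleftrightarrow> v \<noteq> 0\<^sub>v 5 \<and>
    a * vec_index v 0 + b1 * vec_index v 1 + b2 * vec_index v 2 + b3 * vec_index v 3 = z * vec_index v 0 \<and>
    c1 * vec_index v 0 + d1 * vec_index v 1 + (1 - K) * vec_index v 4 = z * vec_index v 1 \<and>
    c2 * vec_index v 0 + d2 * vec_index v 2 + (1 - K) * vec_index v 4 = z * vec_index v 2 \<and>
    c3 * vec_index v 0 + d3 * vec_index v 3 + (1 - K) * vec_index v 4 = z * vec_index v 3 \<and>
    vec_index v 4 = z * vec_index v 4"
proof -
  let ?A = "map_mat complex_of_real chain_mat"
  have dim: "dim_row ?A = 5" "dim_col ?A = 5"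
    by (simp_all add: dim_chain_mat)
  have dv: "dim_vec v = 5" using v by simp
  have prod: "vec_index (?A *\<^sub>v v) i = (\<Sum>j<5. ?A $$ (i, j) * vec_index v j)" if "i < 5" for i
    using that dim dv by (auto simp: scalar_prod_def atLeast0LessThan intro!: sum.cong)
  have "?A *\<^sub>v v = z \<cdot>\<^sub>v v \<longleftrightarrow> (\<forall>i<5. (\<Sum>j<5. ?A $$ (i, j) * vec_index v j) = z * vec_index v i)"
    using dim dv prod by (auto simp: vec_eq_iff)
  also have "\<dots> \<longleftrightarrow> (\<forall>i\<in>{0, 1, 2, 3, 4}. (\<Sum>j<5. ?A $$ (i, j) * vec_index v j) = z * vec_index v i)"
    using less_5_cases by auto
  also have "\<dots> \<longleftrightarrow> a * vec_index v 0 + b1 * vec_index v 1 + b2 * vec_index v 2 + b3 * vec_index v 3 = z * vec_index v 0 \<and>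
    c1 * vec_index v 0 + d1 * vec_index v 1 + (1 - K) * vec_index v 4 = z * vec_index v 1 \<and>
    c2 * vec_index v 0 + d2 * vec_index v 2 + (1 - K) * vec_index v 4 = z * vec_index v 2 \<and>
    c3 * vec_index v 0 + d3 * vec_index v 3 + (1 - K) * vec_index v 4 = z * vec_index v 3 \<and>
    vec_index v 4 = z * vec_index v 4"
    by (simp add: chain_mat_def mat_of_rows_list_def eval_nat_numeral)
  finally show ?thesis
    unfolding eigenvector_def dim using v by blast
qed

lemma chi_eigenvalue:
  assumes "eigenvalue (map_mat complex_of_real chain_mat) z" "z \<noteq> 1"
  shows "chi z = 0"
proof -
  obtain v where ev: "eigenvector (map_mat complex_of_real chain_mat) v z"
    using assms(1) by (auto simp: eigenvalue_def)
  then have v: "v \<in> carrier_vec 5"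
    by (simp add: eigenvector_def dim_chain_mat)
  note E = ev[unfolded eigenvector_chain_mat_iff[OF v]]
  then have v4: "vec_index v 4 = 0" using assms(2) by simp
  have e: "a * vec_index v 0 + b1 * vec_index v 1 + b2 * vec_index v 2 + b3 * vec_index v 3 = z * vec_index v 0"
    "c1 * vec_index v 0 + d1 * vec_index v 1 = z * vec_index v 1"
    "c2 * vec_index v 0 + d2 * vec_index v 2 = z * vec_index v 2"
    "c3 * vec_index v 0 + d3 * vec_index v 3 = z * vec_index v 3"
    using E unfolding v4 by simp_all
  \<comment> \<open>Weighting the residuals of the four equations by cofactors eliminates all
    coordinates but the first.\<close>
  have "chi z * vec_index v 0 =
    (z * vec_index v 0 - (a * vec_index v 0 + b1 * vec_index v 1 + b2 * vec_index v 2 + b3 * vec_index v 3))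
        * ((z - d1) * (z - d2) * (z - d3))
      + b1 * (z * vec_index v 1 - (c1 * vec_index v 0 + d1 * vec_index v 1)) * ((z - d2) * (z - d3))
      + b2 * (z * vec_index v 2 - (c2 * vec_index v 0 + d2 * vec_index v 2)) * ((z - d1) * (z - d3))
      + b3 * (z * vec_index v 3 - (c3 * vec_index v 0 + d3 * vec_index v 3)) * ((z - d1) * (z - d2))"
    unfolding chi_def of_real_mult by Groebner_Basis.algebra
  then have c: "chi z * vec_index v 0 = 0"
    unfolding e by simp
  show ?thesis
  proof (cases "vec_index v 0 = 0")
    case True
    \<comment> \<open>With first coordinate 0, each \<open>z - di\<close> annihilates its coordinate
      and the combination with weights \<open>b1\<close>, \<open>b2\<close>, \<open>b3\<close>
      vanishes. So \<open>chi z\<close> annihilates all coordinates even if \<open>z\<close> is a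
      diagonal entry.\<close>
    have "chi z * vec_index v i = 0" if "i < 5" for i
    proof -
      have "chi z * vec_index v 1 = 0" "chi z * vec_index v 2 = 0" "chi z * vec_index v 3 = 0"
        unfolding chi_def of_real_mult using e unfolding True by Groebner_Basis.algebra+
      then show ?thesis using less_5_cases[OF that] c v4 by (auto simp del: mult_eq_0_iff)
    qed
    moreover have "\<exists>i<5. vec_index v i \<noteq> 0"
      using E v by (auto simp: vec_eq_iff)
    ultimately show ?thesis by auto
  qed (use c in simp)
qed

lemma eigenvalue_chi:
  assumes z: "chi z = 0" and nd: "z \<noteq> d1 \<and> z \<noteq> d2 \<and> z \<noteq> d3 \<or> z = d1 \<and> d1 = d2"
  shows "eigenvalue (map_mat complex_of_real chain_mat) (complex_of_real z)"
proof -
  \<comment> \<open>The generic right eigenvector degenerates to zero at \<open>z = d1 = d2\<close>;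
    there the equal diagonal entries admit \<open>(0, b2, - b1, 0)\<close>, balanced so that the
    first row gives 0.\<close>
  obtain p q r s where "(p, q, r, s) = (if z = d1 then (0, b2, - b1, 0)
    else ((z - d1) * (z - d2) * (z - d3), c1 * ((z - d2) * (z - d3)), c2 * ((z - d1) * (z - d3)), c3 * ((z - d1) * (z - d2))))"
    by (metis prod_cases4)
  then have pqrs: "if z = d1 then p = 0 \<and> q = b2 \<and> r = - b1 \<and> s = 0
    else p = (z - d1) * (z - d2) * (z - d3) \<and> q = c1 * ((z - d2) * (z - d3)) \<and>
      r = c2 * ((z - d1) * (z - d3)) \<and> s = c3 * ((z - d1) * (z - d2))"
    by (simp split: if_splits)
  have nz: "q \<noteq> 0"
    using pqrs nd pos by (auto split: if_splits)
  have eq: "a * p + b1 * q + b2 * r + b3 * s = z * p" "c1 * p + d1 * q = z * q"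
    "c2 * p + d2 * r = z * r" "c3 * p + d3 * s = z * s"
  proof -
    have "a * p + b1 * q + b2 * r + b3 * s = z * p \<and> c1 * p + d1 * q = z * q \<and>
      c2 * p + d2 * r = z * r \<and> c3 * p + d3 * s = z * s"
    proof (cases "z = d1")
      case True
      then show ?thesis using pqrs nd by auto
    next
      case False
      then have d: "p = (z - d1) * (z - d2) * (z - d3)" "q = c1 * ((z - d2) * (z - d3))"
        "r = c2 * ((z - d1) * (z - d3))" "s = c3 * ((z - d1) * (z - d2))"
        using pqrs by auto
      show ?thesis
      proof (intro conjI)
        show "a * p + b1 * q + b2 * r + b3 * s = z * p"
          using z unfolding chi_real d by Groebner_Basis.algebra
      qed (unfold d, Groebner_Basis.algebra+)
    qed
    then show "a * p + b1 * q + b2 * r + b3 * s = z * p" "c1 * p + d1 * q = z * q"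
      "c2 * p + d2 * r = z * r" "c3 * p + d3 * s = z * s" by auto
  qed
  define v where "v = vec 5 (\<lambda>i. complex_of_real ([p, q, r, s, 0] ! i))"
  have v: "v \<in> carrier_vec 5" and vi: "vec_index v 0 = of_real p" "vec_index v 1 = of_real q" "vec_index v 2 = of_real r"
    "vec_index v 3 = of_real s" "vec_index v 4 = 0"
    by (simp_all add: v_def eval_nat_numeral)
  have "v \<noteq> 0\<^sub>v 5"
    using nz vi(2) by auto
  then have "eigenvector (map_mat complex_of_real chain_mat) v z"
    unfolding eigenvector_chain_mat_iff[OF v] vi using eq[THEN arg_cong[where f = complex_of_real]]
    by simp
  then show ?thesis by (auto simp: eigenvalue_def)
qed

end

lemma (in arrow_chain_roots) eigenvalues:
  "{z. eigenvalue (map_mat complex_of_real chain_mat) z \<and> z \<noteq> 1}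
     = {complex_of_real x1, complex_of_real x2, complex_of_real x3, complex_of_real x4}"
proof -
  note I = interlacing K_bounds x
  have "eigenvalue (map_mat complex_of_real chain_mat) (of_real y) \<and> complex_of_real y \<noteq> 1"
    if y: "y \<in> {x1, x2, x3, x4}" for y
  proof
    have "y \<noteq> 1" using y x h d K K_bounds by auto
    then show "complex_of_real y \<noteq> 1" by simp
    have "chi y = 0" using y roots by auto
    \<comment> \<open>By interlacing, a root meets the diagonal only as
      \<open>x2 = d1 = d2\<close>.\<close>
    moreover have "y \<noteq> d1 \<and> y \<noteq> d2 \<and> y \<noteq> d3 \<or> y = d1 \<and> d1 = d2"
      using y I d x_order by (cases "d1 = d2") auto
    ultimately show "eigenvalue (map_mat complex_of_real chain_mat) (of_real y)"
      by (rule eigenvalue_chi)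
  qed
  moreover have "z \<in> {complex_of_real x1, complex_of_real x2, complex_of_real x3, complex_of_real x4}"
    if "eigenvalue (map_mat complex_of_real chain_mat) z" "z \<noteq> 1" for z
    using chi_eigenvalue[OF that] unfolding chi_factor by auto
  ultimately show ?thesis by auto
qed

section \<open>The hand as a random process and its lumping to classes of states\<close>

lemma hand_state_cong: "(\<And>k. k < n \<Longrightarrow> r k = r' k) \<Longrightarrow> hand_state r n = hand_state r' n"
  by (induction n) auto

lemma hand_state_absorbing: "hand_state r m = Seven_out \<Longrightarrow> m \<le> n \<Longrightarrow> hand_state r n = Seven_out"
  by (induction n) (auto simp: le_Suc_eq)

text \<open>A finite infimum of times is attained, and since \<open>Seven_out\<close> is absorbing,
  minimality only has to be checked one roll earlier.\<close>

lemma hand_length_eq_Suc_iff: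
  "hand_length r = enat (Suc m) \<longleftrightarrow> hand_state r m \<noteq> Seven_out \<and> hand_state r (Suc m) = Seven_out"
proof -
  let ?N = "{n. hand_state r n = Seven_out}"
  have L: "hand_length r = enat k \<longleftrightarrow> k \<in> ?N \<and> (\<forall>n\<in>?N. k \<le> n)" for k
  proof
    assume k: "hand_length r = enat k"
    have "?N \<noteq> {}"
    proof
      assume "?N = {}"
      then have "hand_length r = \<infinity>"
        unfolding hand_length_def by (simp only: image_empty Inf_empty top_enat_def)
      then show False using k by simp
    qed
    then obtain z where "z \<in> enat ` ?N" by blast
    then have "Inf (enat ` ?N) \<in> enat ` ?N"
      unfolding Inf_enat_def by (metis (mono_tags, lifting) LeastI empty_iff)
    then have "k \<in> ?N" using k by (auto simp: hand_length_def)
    moreover have "\<forall>n\<in>?N. k \<le> n"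
      using k INF_lower[of _ ?N enat] unfolding hand_length_def by fastforce
    ultimately show "k \<in> ?N \<and> (\<forall>n\<in>?N. k \<le> n)" by blast
  next
    assume "k \<in> ?N \<and> (\<forall>n\<in>?N. k \<le> n)"
    then show "hand_length r = enat k"
      unfolding hand_length_def by (intro antisym INF_greatest) (auto intro: INF_lower)
  qed
  show ?thesis unfolding L
    using hand_state_absorbing[of r _ m] by (auto simp: not_less_eq_eq[symmetric])
qed

text \<open>\<open>game_state\<close> allows any natural number as a point; apart from
  \<open>Seven_out\<close>, these are the states that genuine dice totals can reach.\<close>

definition live_states :: "game_state set" where
  "live_states = {Come_out, Point 4, Point 5, Point 6, Point 8, Point 9, Point 10}"

lemma next_state_live:
  assumes "s \<in> live_states" "xy \<in> {1..6} \<times> {1..6}"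
  shows "next_state s (fst xy + snd xy) \<in> insert Seven_out live_states"
proof -
  have "2 \<le> fst xy + snd xy" "fst xy + snd xy \<le> 12"
    using assms(2) by auto
  then have "fst xy + snd xy \<in> {2, 3, 4, 5, 6, 7, 8, 9, 10, 11, 12}"
    unfolding insert_iff empty_iff by presburger
  then show ?thesis
    using assms(1) by (cases s) (auto simp: live_states_def)
qed

locale hand_process = prob_space M for M :: "'a measure" +
  fixes mdl :: dice_model and \<theta> :: real and R :: "nat \<Rightarrow> 'a \<Rightarrow> nat \<times> nat"
  assumes theta: "0 \<le> \<theta>" "\<theta> \<le> 1" and hand_rolls: "hand_rolls mdl \<theta> M R"
begin

definition st :: "nat \<Rightarrow> 'a \<Rightarrow> game_state" where
  "st n \<omega> = hand_state (\<lambda>k. R k \<omega>) n"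

lemma st_Suc: "st (Suc n) \<omega> = next_state (st n \<omega>) (fst (R n \<omega>) + snd (R n \<omega>))"
  by (simp add: st_def)

lemma R_measurable [measurable]: "R n \<in> measurable M (count_space UNIV)"
  using hand_rolls by (simp add: hand_rolls_def)

lemma st_measurable [measurable]: "st n \<in> measurable M (count_space UNIV)"
proof (induction n)
  case 0
  then show ?case by (simp add: st_def[abs_def])
next
  case (Suc n)
  note [measurable] = Suc
  have "(\<lambda>\<omega>. next_state s (fst (R n \<omega>) + snd (R n \<omega>))) \<in> measurable M (count_space UNIV)" for s
    by measurable
  from measurable_compose_countable[OF this Suc] show ?case
    by (simp add: st_Suc[abs_def])
qed

lemma st_roll_event: "{\<omega> \<in> space M. st n \<omega> = s \<and> R n \<omega> \<in> B} \<in> events"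
  by measurable

text \<open>\<open>hand_rolls\<close> prescribes the next roll given a full history. Summing over
  the countably many histories that lead to \<open>s\<close>, which all have the same conditional
  law, conditions on the state alone.\<close>

lemma prob_st_roll:
  assumes s: "s \<noteq> Seven_out"
  shows "prob {\<omega> \<in> space M. st n \<omega> = s \<and> R n \<omega> = xy} = prob {\<omega> \<in> space M. st n \<omega> = s} * dice_mass mdl \<theta> s xy"
proof -
  define X where "X = {l :: (nat \<times> nat) list. length l = n \<and> hand_state ((!) l) n = s}"
  define cyl where "cyl l = {\<omega> \<in> space M. \<forall>k<n. R k \<omega> = l ! k}" for l
  have cyl_sets [measurable]: "cyl l \<in> events" for l unfolding cyl_def by measurable
  have X: "countable X" by simp
  have disj: "disjoint_family_on (\<lambda>l. cyl l \<inter> B) X" for B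
    unfolding disjoint_family_on_def cyl_def X_def by (auto intro!: nth_equalityI)
  have un: "{\<omega> \<in> space M. st n \<omega> = s \<and> P \<omega>} = (\<Union>l\<in>X. cyl l \<inter> {\<omega> \<in> space M. P \<omega>})" for P
  proof (intro equalityI subsetI)
    fix \<omega> assume w: "\<omega> \<in> {\<omega> \<in> space M. st n \<omega> = s \<and> P \<omega>}"
    define l where "l = map (\<lambda>k. R k \<omega>) [0..<n]"
    have "hand_state ((!) l) n = s"
      using w hand_state_cong[of n "(!) l" "\<lambda>k. R k \<omega>"] by (simp add: l_def st_def)
    then have "l \<in> X" by (simp add: X_def l_def)
    moreover have "\<omega> \<in> cyl l \<inter> {\<omega> \<in> space M. P \<omega>}" using w by (simp add: cyl_def l_def)
    ultimately show "\<omega> \<in> (\<Union>l\<in>X. cyl l \<inter> {\<omega> \<in> space M. P \<omega>})" by blast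
  next
    fix \<omega> assume "\<omega> \<in> (\<Union>l\<in>X. cyl l \<inter> {\<omega> \<in> space M. P \<omega>})"
    then obtain l where l: "l \<in> X" "\<omega> \<in> cyl l" "\<omega> \<in> space M" "P \<omega>" by blast
    then have "st n \<omega> = s"
      using hand_state_cong[of n "(!) l" "\<lambda>k. R k \<omega>"] by (auto simp: cyl_def X_def st_def)
    then show "\<omega> \<in> {\<omega> \<in> space M. st n \<omega> = s \<and> P \<omega>}" using l by simp
  qed
  have mass: "0 \<le> dice_mass mdl \<theta> s xy" using dice_mass_nonneg theta by blast
  have cyl_roll: "emeasure M (cyl l \<inter> {\<omega> \<in> space M. R n \<omega> = xy})
      = emeasure M (cyl l \<inter> {\<omega> \<in> space M. True}) * ennreal (dice_mass mdl \<theta> s xy)" if "l \<in> X" for l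
  proof -
    \<comment> \<open>The history \<open>l\<close> continued by \<open>xy\<close>; only the value at
      position \<open>n\<close> enters beyond the history.\<close>
    define r where "r k = (if k < n then l ! k else xy)" for k
    have r: "hand_state r n = s"
      using that hand_state_cong[of n r "(!) l"] by (simp add: X_def r_def)
    have "prob {\<omega> \<in> space M. \<forall>k\<le>n. R k \<omega> = r k}
        = prob {\<omega> \<in> space M. \<forall>k<n. R k \<omega> = r k} * dice_mass mdl \<theta> s (r n)"
      using hand_rolls[unfolded hand_rolls_def, THEN conjunct2, THEN conjunct2, rule_format, of r n] s
      by (simp add: r)
    moreover have "{\<omega> \<in> space M. \<forall>k\<le>n. R k \<omega> = r k} = cyl l \<inter> {\<omega> \<in> space M. R n \<omega> = xy}"
      by (auto simp: cyl_def r_def le_less)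
    moreover have "{\<omega> \<in> space M. \<forall>k<n. R k \<omega> = r k} = cyl l \<inter> {\<omega> \<in> space M. True}"
      by (auto simp: cyl_def r_def)
    ultimately have "prob (cyl l \<inter> {\<omega> \<in> space M. R n \<omega> = xy})
        = prob (cyl l \<inter> {\<omega> \<in> space M. True}) * dice_mass mdl \<theta> s xy"
      by (simp add: r_def)
    then show ?thesis
      by (simp add: emeasure_eq_measure ennreal_mult mass)
  qed
  have "emeasure M {\<omega> \<in> space M. st n \<omega> = s \<and> R n \<omega> = xy}
      = (\<integral>\<^sup>+l. emeasure M (cyl l \<inter> {\<omega> \<in> space M. R n \<omega> = xy}) \<partial>count_space X)"
    unfolding un by (rule emeasure_UN_countable[OF _ X disj]) measurable
  also have "\<dots> = (\<integral>\<^sup>+l. emeasure M (cyl l \<inter> {\<omega> \<in> space M. True}) * ennreal (dice_mass mdl \<theta> s xy) \<partial>count_space X)"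
    by (intro nn_integral_cong) (simp add: cyl_roll)
  also have "\<dots> = (\<integral>\<^sup>+l. emeasure M (cyl l \<inter> {\<omega> \<in> space M. True}) \<partial>count_space X) * ennreal (dice_mass mdl \<theta> s xy)"
    by (rule nn_integral_multc) simp
  also have "(\<integral>\<^sup>+l. emeasure M (cyl l \<inter> {\<omega> \<in> space M. True}) \<partial>count_space X)
      = emeasure M {\<omega> \<in> space M. st n \<omega> = s \<and> True}"
    unfolding un by (rule emeasure_UN_countable[OF _ X disj, symmetric]) measurable
  finally show ?thesis
    by (simp add: emeasure_eq_measure ennreal_mult[symmetric] mass)
qed

lemma prob_st_roll_in:
  assumes "s \<noteq> Seven_out" "finite B"
  shows "prob {\<omega> \<in> space M. st n \<omega> = s \<and> R n \<omega> \<in> B}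
    = prob {\<omega> \<in> space M. st n \<omega> = s} * (\<Sum>xy\<in>B. dice_mass mdl \<theta> s xy)"
proof -
  have "{\<omega> \<in> space M. st n \<omega> = s \<and> R n \<omega> \<in> B} = (\<Union>xy\<in>B. {\<omega> \<in> space M. st n \<omega> = s \<and> R n \<omega> = xy})"
    by auto
  also have "prob \<dots> = (\<Sum>xy\<in>B. prob {\<omega> \<in> space M. st n \<omega> = s \<and> R n \<omega> = xy})"
    using assms(2) by (intro finite_measure_finite_Union) (auto simp: disjoint_family_on_def)
  finally show ?thesis
    unfolding prob_st_roll[OF assms(1)] by (simp add: sum_distrib_left)
qed

text \<open>The 36 genuine outcomes already carry total mass 1, so the rolls outside them form a
  null event.\<close>

lemma AE_roll:
  assumes "s \<noteq> Seven_out"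
  shows "AE \<omega> in M. st n \<omega> = s \<longrightarrow> R n \<omega> \<in> {1..6} \<times> {1..6}"
proof -
  define B :: "(nat \<times> nat) set" where "B = {1..6} \<times> {1..6}"
  have B: "finite B" "(\<Sum>xy\<in>B. dice_mass mdl \<theta> s xy) = 1"
    unfolding B_def by (simp, rule dice_mass_sum)
  let ?A = "{\<omega> \<in> space M. st n \<omega> = s}" and ?B = "{\<omega> \<in> space M. st n \<omega> = s \<and> R n \<omega> \<in> B}"
  have "prob ?B = prob ?A"
    using prob_st_roll_in[OF assms B(1), of n] B(2) by simp
  moreover have "prob (?A - ?B) = prob ?A - prob ?B"
    by (rule finite_measure_Diff) auto
  moreover have "?A - ?B = {\<omega> \<in> space M. \<not> (st n \<omega> = s \<longrightarrow> R n \<omega> \<in> B)}"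
    by blast
  ultimately have "prob {\<omega> \<in> space M. \<not> (st n \<omega> = s \<longrightarrow> R n \<omega> \<in> B)} = 0"
    by simp
  then have "AE \<omega> in M. st n \<omega> = s \<longrightarrow> R n \<omega> \<in> B"
    by (subst (asm) prob_Collect_eq_0) auto
  then show ?thesis unfolding B_def .
qed

lemma finite_live_states: "finite live_states"
  by (simp add: live_states_def)

lemma live_not_Seven_out: "s \<in> live_states \<Longrightarrow> s \<noteq> Seven_out"
  by (auto simp: live_states_def)

lemma AE_roll_live: "AE \<omega> in M. st n \<omega> \<in> live_states \<longrightarrow> R n \<omega> \<in> {1..6} \<times> {1..6}"
proof -
  have "AE \<omega> in M. \<forall>s\<in>live_states. st n \<omega> = s \<longrightarrow> R n \<omega> \<in> {1..6} \<times> {1..6}"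
    using live_not_Seven_out AE_roll by (subst AE_finite_all[OF finite_live_states]) blast
  then show ?thesis by eventually_elim blast
qed

lemma AE_st: "AE \<omega> in M. st n \<omega> \<in> insert Seven_out live_states"
proof (induction n)
  case 0
  then show ?case by (simp add: st_def live_states_def)
next
  case (Suc n)
  show ?case
    using Suc AE_roll_live[of n]
  proof eventually_elim
    case (elim \<omega>)
    then show ?case
      using next_state_live[of "st n \<omega>" "R n \<omega>"] unfolding st_Suc
      by (cases "st n \<omega> = Seven_out") (auto simp del: mem_Sigma_iff atLeastAtMost_iff)
  qed
qed

definition class_prob :: "nat \<Rightarrow> nat \<Rightarrow> real" where
  "class_prob n j = prob {\<omega> \<in> space M. chain_state (st n \<omega>) = j}"

lemma prob_st_in:
  assumes "finite S"
  shows "prob {\<omega> \<in> space M. st n \<omega> \<in> S} = (\<Sum>s\<in>S. prob {\<omega> \<in> space M. st n \<omega> = s})"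
proof -
  have "{\<omega> \<in> space M. st n \<omega> \<in> S} = (\<Union>s\<in>S. {\<omega> \<in> space M. st n \<omega> = s})"
    by auto
  also have "prob \<dots> = (\<Sum>s\<in>S. prob {\<omega> \<in> space M. st n \<omega> = s})"
    using assms by (intro finite_measure_finite_Union) (auto simp: disjoint_family_on_def)
  finally show ?thesis .
qed

text \<open>\<open>chain_state\<close> also sends unreachable points to class 3; they have
  probability zero by \<open>AE_st\<close>.\<close>

lemma class_prob_eq:
  assumes "j < 4"
  shows "class_prob n j = (\<Sum>s\<in>{s \<in> live_states. chain_state s = j}. prob {\<omega> \<in> space M. st n \<omega> = s})"
proof -
  have "class_prob n j = prob {\<omega> \<in> space M. st n \<omega> \<in> {s \<in> live_states. chain_state s = j}}"
    unfolding class_prob_def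
  proof (rule finite_measure_eq_AE)
    show "AE \<omega> in M. \<omega> \<in> {\<omega> \<in> space M. chain_state (st n \<omega>) = j} \<longleftrightarrow>
        \<omega> \<in> {\<omega> \<in> space M. st n \<omega> \<in> {s \<in> live_states. chain_state s = j}}"
      using AE_st[of n] by eventually_elim (use assms in auto)
  qed measurable
  also have "\<dots> = (\<Sum>s\<in>{s \<in> live_states. chain_state s = j}. prob {\<omega> \<in> space M. st n \<omega> = s})"
    by (rule prob_st_in) (simp add: finite_live_states)
  finally show ?thesis .
qed

text \<open>Lumpability: by \<open>trans_mat_game\<close> the chance to enter class \<open>j\<close>
  depends only on the class of the current state. As \<open>j < 4\<close>, nothing enters from
  \<open>Seven_out\<close>.\<close>

lemma class_prob_Suc:
  assumes j: "j < 4"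
  shows "class_prob (Suc n) j = (\<Sum>i<4. class_prob n i * trans_mat mdl \<theta> $$ (i, j))"
proof -
  define B where "B s = {xy \<in> {1..6} \<times> {1..6}. chain_state (next_state s (fst xy + snd xy)) = j}" for s
  have fin: "finite (B s)" for s unfolding B_def by (rule finite_subset[of _ "{1..6} \<times> {1..6}"]) auto
  have "class_prob (Suc n) j
      = prob (\<Union>s\<in>live_states. {\<omega> \<in> space M. st n \<omega> = s \<and> R n \<omega> \<in> B s})"
    unfolding class_prob_def
  proof (rule finite_measure_eq_AE)
    show "AE \<omega> in M. \<omega> \<in> {\<omega> \<in> space M. chain_state (st (Suc n) \<omega>) = j} \<longleftrightarrow>
        \<omega> \<in> (\<Union>s\<in>live_states. {\<omega> \<in> space M. st n \<omega> = s \<and> R n \<omega> \<in> B s})"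
      using AE_st[of n] AE_roll_live[of n]
      by eventually_elim (use j in \<open>auto simp: st_Suc B_def simp del: mem_Sigma_iff atLeastAtMost_iff\<close>)
    show "(\<Union>s\<in>live_states. {\<omega> \<in> space M. st n \<omega> = s \<and> R n \<omega> \<in> B s}) \<in> events"
      using finite_live_states by (intro sets.finite_UN st_roll_event)
  qed measurable
  also have "\<dots> = (\<Sum>s\<in>live_states. prob {\<omega> \<in> space M. st n \<omega> = s \<and> R n \<omega> \<in> B s})"
    using finite_live_states st_roll_event
    by (intro finite_measure_finite_Union) (auto simp: disjoint_family_on_def)
  also have "\<dots> = (\<Sum>s\<in>live_states. prob {\<omega> \<in> space M. st n \<omega> = s} * trans_mat mdl \<theta> $$ (chain_state s, j))"
  proof (intro sum.cong refl)
    fix s assume s: "s \<in> live_states"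
    have "(\<Sum>xy\<in>B s. dice_mass mdl \<theta> s xy) = trans_mat mdl \<theta> $$ (chain_state s, j)"
      unfolding B_def using s j by (intro trans_mat_game) (simp_all add: live_states_def)
    then show "prob {\<omega> \<in> space M. st n \<omega> = s \<and> R n \<omega> \<in> B s}
        = prob {\<omega> \<in> space M. st n \<omega> = s} * trans_mat mdl \<theta> $$ (chain_state s, j)"
      by (simp add: prob_st_roll_in[OF live_not_Seven_out[OF s] fin])
  qed
  also have "\<dots> = (\<Sum>i<4. \<Sum>s\<in>{s \<in> live_states. chain_state s = i}.
      prob {\<omega> \<in> space M. st n \<omega> = s} * trans_mat mdl \<theta> $$ (chain_state s, j))"
    using finite_live_states by (intro sum.group[symmetric]) (auto simp: live_states_def)
  also have "\<dots> = (\<Sum>i<4. class_prob n i * trans_mat mdl \<theta> $$ (i, j))"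
    by (intro sum.cong refl) (simp add: class_prob_eq sum_distrib_right)
  finally show ?thesis .
qed

lemma prob_alive: "prob {\<omega> \<in> space M. st n \<omega> \<noteq> Seven_out} = (\<Sum>i<4. class_prob n i)"
proof -
  have "prob {\<omega> \<in> space M. st n \<omega> \<noteq> Seven_out} = prob {\<omega> \<in> space M. st n \<omega> \<in> live_states}"
  proof (rule finite_measure_eq_AE)
    show "AE \<omega> in M. \<omega> \<in> {\<omega> \<in> space M. st n \<omega> \<noteq> Seven_out} \<longleftrightarrow> \<omega> \<in> {\<omega> \<in> space M. st n \<omega> \<in> live_states}"
      using AE_st[of n] by eventually_elim (auto dest: live_not_Seven_out)
  qed measurable
  also have "\<dots> = (\<Sum>s\<in>live_states. prob {\<omega> \<in> space M. st n \<omega> = s})"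
    by (rule prob_st_in) (rule finite_live_states)
  also have "\<dots> = (\<Sum>i<4. \<Sum>s\<in>{s \<in> live_states. chain_state s = i}. prob {\<omega> \<in> space M. st n \<omega> = s})"
    using finite_live_states by (intro sum.group[symmetric]) (auto simp: live_states_def)
  also have "\<dots> = (\<Sum>i<4. class_prob n i)"
    by (intro sum.cong refl) (simp add: class_prob_eq)
  finally show ?thesis .
qed

lemma class_prob_0: "class_prob 0 j = (if j = 0 then 1 else 0)"
  by (simp add: class_prob_def st_def prob_space)

text \<open>Being alive at time \<open>Suc m\<close> implies being alive at time \<open>m\<close>,
  so the probability of the difference event is a difference of survival probabilities.\<close>

lemma prob_hand_length:
  "prob {\<omega> \<in> space M. hand_length (\<lambda>n. R n \<omega>) = enat (Suc m)}
     = (\<Sum>i<4. class_prob m i) - (\<Sum>i<4. class_prob (Suc m) i)"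
proof -
  have "{\<omega> \<in> space M. hand_length (\<lambda>n. R n \<omega>) = enat (Suc m)}
      = {\<omega> \<in> space M. st m \<omega> \<noteq> Seven_out} - {\<omega> \<in> space M. st (Suc m) \<omega> \<noteq> Seven_out}"
    by (auto simp: hand_length_eq_Suc_iff st_def)
  also have "prob \<dots> = prob {\<omega> \<in> space M. st m \<omega> \<noteq> Seven_out} - prob {\<omega> \<in> space M. st (Suc m) \<omega> \<noteq> Seven_out}"
    by (rule finite_measure_Diff) (auto simp: st_Suc)
  finally show ?thesis
    unfolding prob_alive .
qed

end

section \<open>The distribution of the hand length, for both models at once\<close>

lemma (in hand_process) survival_chain_mat:
  assumes chain: "arrow_chain_roots a b1 b2 b3 c1 c2 c3 d1 d2 d3 K h x1 x2 x3 x4"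
    and mat: "trans_mat mdl \<theta> = arrow_chain.chain_mat a b1 b2 b3 c1 c2 c3 d1 d2 d3 K"
  defines "C \<equiv> arrow_chain_roots.coeff d1 d2 d3 K"
  shows "(\<Sum>i<4. class_prob n i) = C x1 x2 x3 x4 * x1 ^ n + C x2 x3 x4 x1 * x2 ^ n
     + C x3 x4 x1 x2 * x3 ^ n + C x4 x1 x2 x3 * x4 ^ n"
proof -
  interpret arrow_chain_roots a b1 b2 b3 c1 c2 c3 d1 d2 d3 K h x1 x2 x3 x4 by fact
  have sum4: "(\<Sum>i<4. f i) = f 0 + f 1 + f 2 + f (3 :: nat)" for f :: "nat \<Rightarrow> real"
    by (simp add: eval_nat_numeral)
  have mat_entry: "trans_mat mdl \<theta> $$ (i, j) =
    [[a, b1, b2, b3, 0], [c1, d1, 0, 0, 1 - K], [c2, 0, d2, 0, 1 - K], [c3, 0, 0, d3, 1 - K], [0, 0, 0, 0, 1]] ! i ! j"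
    if "i < 5" "j < 5" for i j
    unfolding mat chain_mat_def mat_of_rows_list_def using that by simp
  have "class_prob n 0 + class_prob n 1 + class_prob n 2 + class_prob n 3 =
      coeff x1 x2 x3 x4 * x1 ^ n + coeff x2 x3 x4 x1 * x2 ^ n
        + coeff x3 x4 x1 x2 * x3 ^ n + coeff x4 x1 x2 x3 * x4 ^ n"
  proof (rule survival)
    fix n
    show "class_prob (Suc n) 0 = a * class_prob n 0 + c1 * class_prob n 1 + c2 * class_prob n 2 + c3 * class_prob n 3"
      "class_prob (Suc n) 1 = b1 * class_prob n 0 + d1 * class_prob n 1"
      "class_prob (Suc n) 2 = b2 * class_prob n 0 + d2 * class_prob n 2"
      "class_prob (Suc n) 3 = b3 * class_prob n 0 + d3 * class_prob n 3"
      by (simp_all add: class_prob_Suc sum4 mat_entry mult.commute)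
  qed (simp_all add: class_prob_0)
  then show ?thesis
    unfolding sum4 C_def .
qed

text \<open>The part specific to a model is isolated in the hypotheses: its matrix entries, and the
  identification of \<open>eig\<close> and \<open>coef\<close> with roots and weights. Differences
  of consecutive survival probabilities turn \<open>x1 ^ m\<close> into
  \<open>x1 ^ m * (1 - x1)\<close>.\<close>

lemma hand_length_distribution:
  fixes mdl :: dice_model and \<theta> :: real
    and M :: "'a measure" and R :: "nat \<Rightarrow> 'a \<Rightarrow> nat \<times> nat"
  assumes chain: "arrow_chain_roots a b1 b2 b3 c1 c2 c3 d1 d2 d3 K h x1 x2 x3 x4"
    and mat: "trans_mat mdl \<theta> = arrow_chain.chain_mat a b1 b2 b3 c1 c2 c3 d1 d2 d3 K"
    and \<theta>: "0 \<le> \<theta>" "\<theta> \<le> 1" and d12: "d2 = d1 \<longleftrightarrow> \<theta> = 1"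
    and eig: "eig mdl 1 \<theta> = x1" "eig mdl 2 \<theta> = x2" "eig mdl 3 \<theta> = x3" "eig mdl 4 \<theta> = x4"
    and coef: "coef mdl 1 \<theta> = arrow_chain_roots.coeff d1 d2 d3 K x1 x2 x3 x4"
      "coef mdl 2 \<theta> = arrow_chain_roots.coeff d1 d2 d3 K x2 x3 x4 x1"
      "coef mdl 3 \<theta> = arrow_chain_roots.coeff d1 d2 d3 K x3 x4 x1 x2"
      "coef mdl 4 \<theta> = arrow_chain_roots.coeff d1 d2 d3 K x4 x1 x2 x3"
  shows "(hand_rolls mdl \<theta> M R \<longrightarrow> (\<forall>x\<ge>2.
            measure M {\<omega> \<in> space M. hand_length (\<lambda>n. R n \<omega>) = enat x}
              = (\<Sum>i=1..4. coef mdl i \<theta> * eig mdl i \<theta> ^ (x - 1) * (1 - eig mdl i \<theta>)) \<and>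
            (\<Sum>i=1..4. coef mdl i \<theta> * eig mdl i \<theta> ^ (x - 1) * (1 - eig mdl i \<theta>))
              = (\<Sum>i=1..4. coef mdl i \<theta> * GEOM (1 - eig mdl i \<theta>) x))) \<and>
         1 > eig mdl 1 \<theta> \<and> eig mdl 1 \<theta> > eig mdl 2 \<theta> \<and> eig mdl 2 \<theta> > eig mdl 3 \<theta> \<and>
         eig mdl 3 \<theta> > eig mdl 4 \<theta> \<and> eig mdl 4 \<theta> > 0 \<and>
         {z :: complex. eigenvalue (map_mat complex_of_real (trans_mat mdl \<theta>)) z \<and> z \<noteq> 1}
           = {complex_of_real (eig mdl 1 \<theta>), complex_of_real (eig mdl 2 \<theta>),
              complex_of_real (eig mdl 3 \<theta>), complex_of_real (eig mdl 4 \<theta>)} \<and>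
         coef mdl 1 \<theta> > 0 \<and>
         (if \<theta> < 1 then coef mdl 2 \<theta> < 0 else coef mdl 2 \<theta> = 0) \<and>
         coef mdl 3 \<theta> < 0 \<and> coef mdl 4 \<theta> < 0 \<and>
         coef mdl 1 \<theta> + coef mdl 2 \<theta> + coef mdl 3 \<theta> + coef mdl 4 \<theta> = 1 \<and>
         coef mdl 1 \<theta> * eig mdl 1 \<theta> + coef mdl 2 \<theta> * eig mdl 2 \<theta>
           + coef mdl 3 \<theta> * eig mdl 3 \<theta> + coef mdl 4 \<theta> * eig mdl 4 \<theta> = 1"
proof -
  interpret arrow_chain_roots a b1 b2 b3 c1 c2 c3 d1 d2 d3 K h x1 x2 x3 x4 by fact
  have sum4: "(\<Sum>i=1..4. f i) = f 1 + f 2 + f 3 + f (4 :: nat)" for f :: "nat \<Rightarrow> real"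
    by (simp add: eval_nat_numeral)
  have prob: "measure M {\<omega> \<in> space M. hand_length (\<lambda>n. R n \<omega>) = enat x}
      = (\<Sum>i=1..4. coef mdl i \<theta> * eig mdl i \<theta> ^ (x - 1) * (1 - eig mdl i \<theta>))"
    if hr: "hand_rolls mdl \<theta> M R" and x: "x \<ge> 2" for x
  proof -
    interpret prob_space M using hr by (simp add: hand_rolls_def)
    interpret hand_process M mdl \<theta> R
      using hr \<theta> by unfold_locales
    obtain m where m: "x = Suc m" using x by (cases x) auto
    show ?thesis
      unfolding m prob_hand_length survival_chain_mat[OF chain mat] sum4 eig coef
      by (simp add: algebra_simps)
  qed
  have geom: "(\<Sum>i=1..4. coef mdl i \<theta> * eig mdl i \<theta> ^ (x - 1) * (1 - eig mdl i \<theta>))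
      = (\<Sum>i=1..4. coef mdl i \<theta> * GEOM (1 - eig mdl i \<theta>) x)" for x
    by (simp add: GEOM_def mult.assoc)
  have c2: "if \<theta> < 1 then coef mdl 2 \<theta> < 0 else coef mdl 2 \<theta> = 0"
    using coeff_signs(2,3) d12 \<theta> interlacing(4,5) unfolding coef by fastforce
  show ?thesis
    using prob geom x x_order eigenvalues[folded mat] coeff_signs coeff_sum c2
    unfolding eig coef by blast
qed

text \<open>Depresses the quartic of the eigenvalues: with \<open>m = k * E1 / 4\<close> the new
  roots sum to zero, and \<open>k\<close> clears denominators.\<close>

lemma quartic_esym_affine:
  fixes x1 x2 x3 x4 k m :: real
  assumes "x1 + x2 + x3 + x4 = E1"
    and "x1*x2 + x1*x3 + x1*x4 + x2*x3 + x2*x4 + x3*x4 = E2"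
    and "x1*x2*x3 + x1*x2*x4 + x1*x3*x4 + x2*x3*x4 = E3"
    and "x1*x2*x3*x4 = E4"
    and "y1 = k * x1 - m" "y2 = k * x2 - m" "y3 = k * x3 - m" "y4 = k * x4 - m"
  shows "y1 + y2 + y3 + y4 = k * E1 - 4 * m"
    and "y1*y2 + y1*y3 + y1*y4 + y2*y3 + y2*y4 + y3*y4 = k^2 * E2 - 3 * k * m * E1 + 6 * m^2"
    and "y1*y2*y3 + y1*y2*y4 + y1*y3*y4 + y2*y3*y4 = k^3 * E3 - 2 * k^2 * m * E2 + 3 * k * m^2 * E1 - 4 * m^3"
    and "y1*y2*y3*y4 = k^4 * E4 - k^3 * m * E3 + k^2 * m^2 * E2 - k * m^3 * E1 + m^4"
  unfolding assms(1-4)[symmetric] assms(5-8) by Groebner_Basis.algebra+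

lemma powers_in_unit_interval:
  fixes \<theta> :: real
  assumes "0 \<le> \<theta>" "\<theta> \<le> 1"
  shows "0 \<le> \<theta>^2" "\<theta>^2 \<le> 1" "0 \<le> \<theta>^3" "\<theta>^3 \<le> 1" "0 \<le> \<theta>^4" "\<theta>^4 \<le> 1"
  using assms by (auto intro: power_le_one)

lemma smult_mat_of_rows_list:
  assumes "\<forall>r\<in>set rs. length r = n"
  shows "k \<cdot>\<^sub>m mat_of_rows_list n rs = mat_of_rows_list n (map (map ((*) k)) rs)"
  using assms by (intro eq_matI) (auto simp: mat_of_rows_list_def)

section \<open>The Smith--Scott model\<close>

locale ss_model =
  fixes \<theta> :: real
  assumes theta: "0 \<le> \<theta>" "\<theta> \<le> 1"
begin

text \<open>The value of \<open>K\<close> is 1 minus the common entry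
  \<open>6 * (4 - \<theta>) / 144\<close> of the last column. As \<open>h\<close>, 73/100 lies below
  \<open>d1 = 3 / 4\<close> with \<open>chi\<close> positive throughout; \<open>d2\<close> could not
  serve, since \<open>chi d2\<close> vanishes at \<open>\<theta> = 1\<close>.\<close>

sublocale arrow_chain "(4 - \<theta>) / 12" "(4 - \<theta>) / 24" "(8 + \<theta>) / 36" "(20 + 7 * \<theta>) / 72"
  "(2 + \<theta>) / 24" "(8 + \<theta>) / 72" "(20 + 7 * \<theta>) / 144" "3 / 4" "(26 + \<theta>) / 36" "(100 - \<theta>) / 144"
  "(20 + \<theta>) / 24" "73 / 100"
  using theta by unfold_locales (auto simp: field_simps)

lemma mat: "trans_mat SS \<theta> = chain_mat"
proof -
  have "trans_mat_ss \<theta> = chain_mat"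
    unfolding chain_mat_def trans_mat_ss_def
    by (subst smult_mat_of_rows_list) (simp, rule arg_cong[where f = "mat_of_rows_list 5"], simp add: field_simps)
  then show ?thesis by simp
qed

lemma chi_signs: "chi (0 :: real) > 0" "chi (1 / 2 :: real) < 0" "chi (73 / 100 :: real) > 0"
proof -
  note b = theta powers_in_unit_interval[OF theta]
  \<comment> \<open>Over a positive denominator these are quartics in \<theta> with signs so clear
    that bounding each power by 0 and 1 decides them linearly.\<close>
  have "chi 0 = (252800 - 144032 * \<theta> - 10176 * \<theta> ^ 2 - 176 * \<theta> ^ 3 - 1 * \<theta> ^ 4) / 2985984"
    unfolding chi_real by (simp add: field_simps power_numeral_reduce)
  also have "\<dots> > 0" using b by (intro divide_pos_pos; linarith)
  finally show "chi (0 :: real) > 0" .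
  have "chi (1 / 2) = (-17152 - 9824 * \<theta> - 1392 * \<theta> ^ 2 - 62 * \<theta> ^ 3 - 1 * \<theta> ^ 4) / 2985984"
    unfolding chi_real by (simp add: field_simps power_numeral_reduce)
  also have "\<dots> < 0" using b by (intro divide_neg_pos; linarith)
  finally show "chi (1 / 2 :: real) < 0" .
  have "chi (73 / 100) = (20441024 + 11126800 * \<theta> - 4256250 * \<theta> ^ 2 - 3734375 * \<theta> ^ 3 - 390625 * \<theta> ^ 4) / 1166400000000"
    unfolding chi_real by (simp add: field_simps power_numeral_reduce)
  also have "\<dots> > 0" using b by (intro divide_pos_pos; linarith)
  finally show "chi (73 / 100 :: real) > 0" .
qed

end

locale ss_roots = ss_model + arrow_chain_roots "(4 - \<theta>) / 12" "(4 - \<theta>) / 24" "(8 + \<theta>) / 36" "(20 + 7 * \<theta>) / 72"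
  "(2 + \<theta>) / 24" "(8 + \<theta>) / 72" "(20 + 7 * \<theta>) / 144" "3 / 4" "(26 + \<theta>) / 36" "(100 - \<theta>) / 144"
  "(20 + \<theta>) / 24" "73 / 100"
begin

lemma esym:
  "x1 + x2 + x3 + x4 = (40 - \<theta>) / 16"
  "x1*x2 + x1*x3 + x1*x4 + x2*x3 + x2*x4 + x3*x4 = (22904 - 1870 * \<theta> - 55 * \<theta> ^ 2) / 10368"
  "x1*x2*x3 + x1*x2*x4 + x1*x3*x4 + x2*x3*x4 = (195424 - 40920 * \<theta> - 2124 * \<theta> ^ 2 - 19 * \<theta> ^ 3) / 248832"
  "x1*x2*x3*x4 = (252800 - 144032 * \<theta> - 10176 * \<theta> ^ 2 - 176 * \<theta> ^ 3 - \<theta> ^ 4) / 2985984"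
  unfolding vieta by (simp_all add: field_simps power_numeral_reduce)

lemma ss_e_eq: "ss_e 1 1 \<theta> = x1" "ss_e 1 (- 1) \<theta> = x2" "ss_e (- 1) 1 \<theta> = x3" "ss_e (- 1) (- 1) \<theta> = x4"
proof -
  \<comment> \<open>A quarter of 576 times the root sum.\<close>
  define m where "m = 360 - 9 * \<theta>"
  define y where "y x = 576 * x - m" for x
  note E = quartic_esym_affine[OF esym, where k = 576 and m = m, OF y_def y_def y_def y_def, unfolded m_def]
  have sum: "y x1 + y x2 + y x3 + y x4 = 0"
    unfolding E by (simp add: field_simps)
  have t: "y x1*y x2 + y x1*y x3 + y x1*y x4 + y x2*y x3 + y x2*y x4 + y x3*y x4 = - 2 * ss_t \<theta>"
    unfolding E ss_t_def by (simp add: field_simps power_numeral_reduce)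
  \<comment> \<open>The factor 6 here and \<open>k = 8\<close> below are those in front of
    \<open>ss_s\<close> and \<open>ss_\<alpha>\<close> in \<open>ss_e\<close>.\<close>
  have S: "y x1*y x2*y x3 + y x1*y x2*y x4 + y x1*y x3*y x4 + y x2*y x3*y x4 = - 4 * (6 * ss_s \<theta>)"
    unfolding E ss_s_def by (simp add: field_simps power_numeral_reduce)
  have r: "3 * (y x1*y x2*y x3*y x4) = 4 * 8^2 * ss_r \<theta> - (ss_t \<theta>)^2"
    unfolding E ss_r_def ss_t_def by (simp add: field_simps power_numeral_reduce)
  have q: "8^3 * ss_q \<theta> = (ss_t \<theta>)^3 - 3 * 8^2 * ss_r \<theta> * ss_t \<theta> - 27 / 4 * (6 * ss_s \<theta>)^2"
    unfolding ss_q_def ss_r_def ss_t_def ss_s_def by (simp add: field_simps power_numeral_reduce)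
  have ord: "y x1 > y x2" "y x2 > y x3" "y x3 > y x4"
    using x_order by (auto simp: y_def)
  note Y = depressed_quartic_roots[OF ord sum t S r _ q, folded ss_\<alpha>_def]
  have aux: "576 * (5 / 8 - \<theta> / 64 + u / 576 * A + v / 576 * B) - m = u * A + v * B" for u v A B
    by (simp add: m_def field_simps)
  have e: "x = ss_e u v \<theta>"
    if "y x = u * sqrt ((ss_t \<theta> + 8 * ss_\<alpha> \<theta>) / 3)
     + v * sqrt ((2 * ss_t \<theta> - 8 * ss_\<alpha> \<theta>) / 3
                        - 6 * u * ss_s \<theta> * sqrt (3 / (ss_t \<theta> + 8 * ss_\<alpha> \<theta>)))" for x u v
  proof -
    have "y x = 576 * ss_e u v \<theta> - m"
      unfolding that ss_e_def by (rule aux[symmetric])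
    then show ?thesis by (simp add: y_def)
  qed
  show "ss_e 1 1 \<theta> = x1" "ss_e 1 (- 1) \<theta> = x2" "ss_e (- 1) 1 \<theta> = x3" "ss_e (- 1) (- 1) \<theta> = x4"
    by (rule e[symmetric]; use Y[OF zero_less_numeral] in simp)+
qed

lemma ss_c_eq:
  assumes "{e, f, g, i} = {x1, x2, x3, x4}" "distinct [e, f, g, i]"
  shows "ss_c e f g i \<theta> = coeff e f g i"
proof -
  \<comment> \<open>The common factor is \<open>4 * 36 * 144 * 24^3\<close> in the numerator and
    \<open>1152 * 24 * 72 * 144\<close> in the denominator.\<close>
  have num: "(3 - 4 * e) * (26 + \<theta> - 36 * e) * (100 - \<theta> - 144 * e)
       * ((20 + \<theta> - 24 * f) * (20 + \<theta> - 24 * g) * (20 + \<theta> - 24 * i))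
    = 286654464 * ((3 / 4 - e) * ((26 + \<theta>) / 36 - e) * ((100 - \<theta>) / 144 - e)
       * (((20 + \<theta>) / 24 - f) * ((20 + \<theta>) / 24 - g) * ((20 + \<theta>) / 24 - i)))"
    by (simp add: field_simps power_numeral_reduce)
  have den: "1152 * (2 + \<theta>) * (8 + \<theta>) * (20 + 7 * \<theta>) * (f - e) * (g - e) * (i - e)
    = 286654464 * ((2 + \<theta>) / 24 * ((8 + \<theta>) / 72) * ((20 + 7 * \<theta>) / 144) * ((f - e) * (g - e) * (i - e)))"
    by (simp add: field_simps power_numeral_reduce)
  show ?thesis
    unfolding coeff_eq_product[OF assms] ss_c_def num den by (rule mult_divide_mult_cancel_left) simp
qed

end

section \<open>The Wong--Shackleford model\<close>

locale ws_model =
  fixes \<theta> :: real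
  assumes theta: "0 \<le> \<theta>" "\<theta> \<le> 1"
begin

text \<open>No constant \<open>h\<close> would do: it must be below \<open>d1 = 3 / 4\<close> at
  \<open>\<theta> = 0\<close>, but above the third root, which exceeds \<open>d3 = 7 / 9\<close> at
  \<open>\<theta> = 1\<close>. So \<open>h\<close> grows with the diagonal entries.\<close>

sublocale arrow_chain "(6 + \<theta>) / 18" "(3 - \<theta>) / 18" "2 / 9" "5 / 18"
  "(3 + \<theta>) / 36" "1 / 9" "(5 + \<theta>) / 36" "(9 + \<theta>) / 12" "(13 + 2 * \<theta>) / 18" "(25 + 3 * \<theta>) / 36"
  "(15 + 2 * \<theta>) / 18" "(73 + 9 * \<theta>) / 100"
  using theta by unfold_locales (auto simp: field_simps)

lemma mat: "trans_mat WS \<theta> = chain_mat"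
proof -
  have "trans_mat_ws \<theta> = chain_mat"
    unfolding chain_mat_def trans_mat_ws_def
    by (subst smult_mat_of_rows_list) (simp, rule arg_cong[where f = "mat_of_rows_list 5"], simp add: field_simps)
  then show ?thesis by simp
qed

lemma chi_signs: "chi (0 :: real) > 0" "chi (1 / 2 :: real) < 0" "chi ((73 + 9 * \<theta>) / 100) > 0"
proof -
  note b = theta powers_in_unit_interval[OF theta]
  have "chi 0 = (17775 + 11457 * \<theta> + 2768 * \<theta> ^ 2 + 298 * \<theta> ^ 3 + 12 * \<theta> ^ 4) / 209952"
    unfolding chi_real by (simp add: field_simps power_numeral_reduce)
  also have "\<dots> > 0" using b by (intro divide_pos_pos; linarith)
  finally show "chi (0 :: real) > 0" .
  have "chi (1 / 2) = (-1206 - 1125 * \<theta> - 238 * \<theta> ^ 2 + 37 * \<theta> ^ 3 + 12 * \<theta> ^ 4) / 209952"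
    unfolding chi_real by (simp add: field_simps power_numeral_reduce)
  also have "\<dots> < 0" using b by (intro divide_neg_pos; linarith)
  finally show "chi (1 / 2 :: real) < 0" .
  have "chi ((73 + 9 * \<theta>) / 100) = (2874519 - 633267 * \<theta> + 470671 * \<theta> ^ 2 - 70213 * \<theta> ^ 3 - 40926 * \<theta> ^ 4) / 164025000000"
    unfolding chi_real by (simp add: field_simps power_numeral_reduce)
  also have "\<dots> > 0" using b by (intro divide_pos_pos; linarith)
  finally show "chi ((73 + 9 * \<theta>) / 100) > 0" .
qed

end

locale ws_roots = ws_model + arrow_chain_roots "(6 + \<theta>) / 18" "(3 - \<theta>) / 18" "2 / 9" "5 / 18"
  "(3 + \<theta>) / 36" "1 / 9" "(5 + \<theta>) / 36" "(9 + \<theta>) / 12" "(13 + 2 * \<theta>) / 18" "(25 + 3 * \<theta>) / 36"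
  "(15 + 2 * \<theta>) / 18" "(73 + 9 * \<theta>) / 100"
begin

lemma esym:
  "x1 + x2 + x3 + x4 = (15 + 2 * \<theta>) / 6"
  "x1*x2 + x1*x3 + x1*x4 + x2*x3 + x2*x4 + x3*x4 = (2863 + 786 * \<theta> + 55 * \<theta> ^ 2) / 1296"
  "x1*x2*x3 + x1*x2*x4 + x1*x3*x4 + x2*x3*x4 = (18321 + 7926 * \<theta> + 1163 * \<theta> ^ 2 + 58 * \<theta> ^ 3) / 23328"
  "x1*x2*x3*x4 = (17775 + 11457 * \<theta> + 2768 * \<theta> ^ 2 + 298 * \<theta> ^ 3 + 12 * \<theta> ^ 4) / 209952"
  unfolding vieta by (simp_all add: field_simps power_numeral_reduce)

lemma ws_e_eq: "ws_e 1 1 \<theta> = x1" "ws_e 1 (- 1) \<theta> = x2" "ws_e (- 1) 1 \<theta> = x3" "ws_e (- 1) (- 1) \<theta> = x4"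
proof -
  define m where "m = 45 + 6 * \<theta>"
  define y where "y x = 72 * x - m" for x
  note E = quartic_esym_affine[OF esym, where k = 72 and m = m, OF y_def y_def y_def y_def, unfolded m_def]
  have sum: "y x1 + y x2 + y x3 + y x4 = 0"
    unfolding E by (simp add: field_simps)
  have t: "y x1*y x2 + y x1*y x3 + y x1*y x4 + y x2*y x3 + y x2*y x4 + y x3*y x4 = - 2 * ws_t \<theta>"
    unfolding E ws_t_def by (simp add: field_simps power_numeral_reduce)
  have S: "y x1*y x2*y x3 + y x1*y x2*y x4 + y x1*y x3*y x4 + y x2*y x3*y x4 = - 4 * (2 * ws_s \<theta>)"
    unfolding E ws_s_def by (simp add: field_simps power_numeral_reduce)
  have r: "3 * (y x1*y x2*y x3*y x4) = 4 * 1^2 * ws_r \<theta> - (ws_t \<theta>)^2"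
    unfolding E ws_r_def ws_t_def by (simp add: field_simps power_numeral_reduce)
  \<comment> \<open>The general formula divides by \<open>2 * r powr (3 / 2)\<close>, whereas
    \<open>ws_\<alpha>\<close> has no factor 2 there; hence twice \<open>ws_q\<close>.\<close>
  have q: "1^3 * (2 * ws_q \<theta>) = (ws_t \<theta>)^3 - 3 * 1^2 * ws_r \<theta> * ws_t \<theta> - 27 / 4 * (2 * ws_s \<theta>)^2"
    unfolding ws_q_def ws_r_def ws_t_def ws_s_def by (simp add: field_simps power_numeral_reduce)
  have ord: "y x1 > y x2" "y x2 > y x3" "y x3 > y x4"
    using x_order by (auto simp: y_def)
  have k1: "(1 :: real) > 0" by simp
  have \<alpha>: "2 * sqrt (ws_r \<theta>) * cos (1 / 3 * arccos (- (2 * ws_q \<theta>) / (2 * ws_r \<theta> powr (3 / 2)))) = ws_\<alpha> \<theta>"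
    by (simp add: ws_\<alpha>_def)
  note Y = depressed_quartic_roots[OF ord sum t S r k1 q, unfolded \<alpha>]
  have aux: "72 * (5 / 8 + \<theta> / 12 + u / 72 * A + v / 72 * B) - m = u * A + v * B" for u v A B
    by (simp add: m_def field_simps)
  have e: "x = ws_e u v \<theta>"
    if "y x = u * sqrt ((ws_t \<theta> + ws_\<alpha> \<theta>) / 3)
     + v * sqrt ((2 * ws_t \<theta> - ws_\<alpha> \<theta>) / 3
                        - 2 * u * ws_s \<theta> * sqrt (3 / (ws_t \<theta> + ws_\<alpha> \<theta>)))" for x u v
  proof -
    have "y x = 72 * ws_e u v \<theta> - m"
      unfolding that ws_e_def by (rule aux[symmetric])
    then show ?thesis by (simp add: y_def)
  qed
  show "ws_e 1 1 \<theta> = x1" "ws_e 1 (- 1) \<theta> = x2" "ws_e (- 1) 1 \<theta> = x3" "ws_e (- 1) (- 1) \<theta> = x4"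
    by (rule e[symmetric]; use Y in simp)+
qed

text \<open>The twelve monomials in \<^const>\<open>ws_d\<close> are those of the monomial symmetric function of type
  (3, 2, 1) that have a negative sign in the Vandermonde product, and the polynomial in \<open>\<theta>\<close> is
  half that symmetric function, up to the common factor.\<close>

lemma ws_d_eq:
  "ws_d \<theta> = - ((3 + \<theta>) * (5 + \<theta>) * 272097792
     * ((x1 - x2) * (x1 - x3) * (x1 - x4) * (x2 - x3) * (x2 - x4) * (x3 - x4)))"
proof -
  define Q V E1 E2 E3 E4 where
    Q: "Q = x1 ^ 2 * x2 ^ 3 * x3 + x1 ^ 3 * x2 * x3 ^ 2
        + x1 * x2 ^ 2 * x3 ^ 3 + x1 ^ 3 * x2 ^ 2 * x4 + x1 ^ 2 * x2 * x4 ^ 3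
        + x1 * x2 ^ 3 * x4 ^ 2 + x1 ^ 2 * x3 ^ 3 * x4 + x1 ^ 3 * x3 * x4 ^ 2
        + x1 * x3 ^ 2 * x4 ^ 3 + x2 ^ 3 * x3 ^ 2 * x4 + x2 ^ 2 * x3 * x4 ^ 3
        + x2 * x3 ^ 3 * x4 ^ 2"
    and V: "V = (x1 - x2) * (x1 - x3) * (x1 - x4) * (x2 - x3) * (x2 - x4) * (x3 - x4)"
    and E: "E1 = x1 + x2 + x3 + x4" "E2 = x1*x2 + x1*x3 + x1*x4 + x2*x3 + x2*x4 + x3*x4"
      "E3 = x1*x2*x3 + x1*x2*x4 + x1*x3*x4 + x2*x3*x4" "E4 = x1*x2*x3*x4"
  \<comment> \<open>\<open>V\<close> is the sum of the positive monomials minus \<open>Q\<close>, so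
    the left side is symmetric and expressible through \<open>E1\<close> to
    \<open>E4\<close>.\<close>
  have "2 * Q + V = E1 * E2 * E3 - 3 * E1^2 * E4 - 3 * E3^2 + 4 * E2 * E4"
    unfolding Q V E by Groebner_Basis.algebra
  also have "272097792 * \<dots> = 448331256 + 349805385 * \<theta> + 113332133 * \<theta> ^ 2 + 19480471 * \<theta> ^ 3
          + 1870151 * \<theta> ^ 4 + 94864 * \<theta> ^ 5 + 1980 * \<theta> ^ 6"
    unfolding E esym by (simp add: field_simps power_numeral_reduce)
  finally have "544195584 * Q - (448331256 + 349805385 * \<theta> + 113332133 * \<theta> ^ 2 + 19480471 * \<theta> ^ 3
          + 1870151 * \<theta> ^ 4 + 94864 * \<theta> ^ 5 + 1980 * \<theta> ^ 6) = - (272097792 * V)"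
    by simp
  then show ?thesis
    unfolding ws_d_def Let_def ws_e_eq Q[symmetric] V[symmetric] by simp
qed

text \<open>\<open>ws_d\<close> contains the full Vandermonde product, and the numerator three of
  its factors; what remains after cancelling are the differences with \<open>e\<close>. The sign
  \<open>\<sigma>\<close> is that of the permutation of the roots.\<close>

lemma ws_c_eq:
  assumes "{e, f, g, i} = {x1, x2, x3, x4}" "distinct [e, f, g, i]"
    and V: "(x1 - x2) * (x1 - x3) * (x1 - x4) * (x2 - x3) * (x2 - x4) * (x3 - x4)
      = \<sigma> * ((e - f) * (e - g) * (e - i) * ((f - g) * (f - i) * (g - i)))" and \<sigma>: "\<sigma> = 1 \<or> \<sigma> = - 1"
  shows "\<sigma> * ws_c e f g i \<theta> = coeff e f g i"
proof -
  define W where "W = (f - g) * (f - i) * (g - i)"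
  define N where "N = ((9 + \<theta>) / 12 - e) * ((13 + 2 * \<theta>) / 18 - e) * ((25 + 3 * \<theta>) / 36 - e)
    * (((15 + 2 * \<theta>) / 18 - f) * ((15 + 2 * \<theta>) / 18 - g) * ((15 + 2 * \<theta>) / 18 - i))"
  define D where "D = (3 + \<theta>) / 36 * (1 / 9) * ((5 + \<theta>) / 36) * ((f - e) * (g - e) * (i - e))"
  have W0: "W \<noteq> 0" using assms(2) by (simp add: W_def)
  have "69984 * (9 + \<theta> - 12 * e) * (13 + 2 * \<theta> - 18 * e) * (25 + 3 * \<theta> - 36 * e)
       * (f - g) * (f - i) * (g - i)
       * ((15 + 2 * \<theta> - 18 * f) * (15 + 2 * \<theta> - 18 * g) * (15 + 2 * \<theta> - 18 * i))
    = 3173748645888 * W * N"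
  proof -
    have scale: "9 + \<theta> - 12 * e = 12 * ((9 + \<theta>) / 12 - e)"
      "25 + 3 * \<theta> - 36 * e = 36 * ((25 + 3 * \<theta>) / 36 - e)"
      "13 + 2 * \<theta> - 18 * e = 18 * ((13 + 2 * \<theta>) / 18 - e)"
      "15 + 2 * \<theta> - 18 * z = 18 * ((15 + 2 * \<theta>) / 18 - z)" for z
      by simp_all
    have "69984 * (12 * p1) * (18 * p2) * (36 * p3) * w1 * w2 * w3 * ((18 * p4) * (18 * p5) * (18 * p6))
        = 3173748645888 * (w1 * w2 * w3) * (p1 * p2 * p3 * (p4 * p5 * p6))"
      for p1 p2 p3 p4 p5 p6 w1 w2 w3 :: real
      by simp
    then show ?thesis
      unfolding N_def W_def scale .
  qed
  moreover have "ws_d \<theta> = \<sigma> * (3173748645888 * W * D)"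
  proof -
    have "- (A * B * 272097792 * (\<sigma> * (p * q * r * w)))
        = \<sigma> * (3173748645888 * w * (A / 36 * (1 / 9) * (B / 36) * (- p * - q * - r)))" for A B p q r w
      by simp
    from this[of "3 + \<theta>" "5 + \<theta>" "e - f" "e - g" "e - i" W] show ?thesis
      unfolding ws_d_eq V D_def W_def minus_diff_eq .
  qed
  ultimately have "ws_c e f g i \<theta> = (3173748645888 * W * N) / (\<sigma> * (3173748645888 * W * D))"
    unfolding ws_c_def by simp
  then have "\<sigma> * ws_c e f g i \<theta> = N / D"
    using \<sigma> W0 by auto
  then show ?thesis
    unfolding coeff_eq_product[OF assms(1,2)] N_def D_def .
qed

end

section \<open>The hand length in the two models\<close>

theorem theorem2:
  fixes mdl :: dice_model and \<theta> :: real
    and M :: "'a measure" and R :: "nat \<Rightarrow> 'a \<Rightarrow> nat \<times> nat"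
  assumes "0 \<le> \<theta>" and "\<theta> \<le> 1"
  shows "(hand_rolls mdl \<theta> M R \<longrightarrow> (\<forall>x\<ge>2.
            measure M {\<omega> \<in> space M. hand_length (\<lambda>n. R n \<omega>) = enat x}
              = (\<Sum>i=1..4. coef mdl i \<theta> * eig mdl i \<theta> ^ (x - 1) * (1 - eig mdl i \<theta>)) \<and>
            (\<Sum>i=1..4. coef mdl i \<theta> * eig mdl i \<theta> ^ (x - 1) * (1 - eig mdl i \<theta>))
              = (\<Sum>i=1..4. coef mdl i \<theta> * GEOM (1 - eig mdl i \<theta>) x))) \<and>
         1 > eig mdl 1 \<theta> \<and> eig mdl 1 \<theta> > eig mdl 2 \<theta> \<and> eig mdl 2 \<theta> > eig mdl 3 \<theta> \<and>
         eig mdl 3 \<theta> > eig mdl 4 \<theta> \<and> eig mdl 4 \<theta> > 0 \<and>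
         {z :: complex. eigenvalue (map_mat complex_of_real (trans_mat mdl \<theta>)) z \<and> z \<noteq> 1}
           = {complex_of_real (eig mdl 1 \<theta>), complex_of_real (eig mdl 2 \<theta>),
              complex_of_real (eig mdl 3 \<theta>), complex_of_real (eig mdl 4 \<theta>)} \<and>
         coef mdl 1 \<theta> > 0 \<and>
         (if \<theta> < 1 then coef mdl 2 \<theta> < 0 else coef mdl 2 \<theta> = 0) \<and>
         coef mdl 3 \<theta> < 0 \<and> coef mdl 4 \<theta> < 0 \<and>
         coef mdl 1 \<theta> + coef mdl 2 \<theta> + coef mdl 3 \<theta> + coef mdl 4 \<theta> = 1 \<and>
         coef mdl 1 \<theta> * eig mdl 1 \<theta> + coef mdl 2 \<theta> * eig mdl 2 \<theta>
           + coef mdl 3 \<theta> * eig mdl 3 \<theta> + coef mdl 4 \<theta> * eig mdl 4 \<theta> = 1"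
proof (cases mdl)
  case SS
  interpret ss_model \<theta>
    using assms by unfold_locales
  obtain x1 x2 x3 x4 where x: "ss_roots \<theta> x1 x2 x3 x4"
    using roots_exist[OF chi_signs] ss_model_axioms by (metis ss_roots.intro)
  interpret ss_roots \<theta> x1 x2 x3 x4 by fact
  have dist: "distinct [x1, x2, x3, x4]" using x_order by auto
  have eig: "eig SS 1 \<theta> = x1" "eig SS 2 \<theta> = x2" "eig SS 3 \<theta> = x3" "eig SS 4 \<theta> = x4"
    by (simp_all add: eig_def ss_e_eq)
  have "ss_c x1 x2 x3 x4 \<theta> = coeff x1 x2 x3 x4" "ss_c x2 x3 x4 x1 \<theta> = coeff x2 x3 x4 x1"
    "ss_c x3 x4 x1 x2 \<theta> = coeff x3 x4 x1 x2" "ss_c x4 x1 x2 x3 \<theta> = coeff x4 x1 x2 x3"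
    by (rule ss_c_eq; use dist in auto)+
  then have coef: "coef SS 1 \<theta> = coeff x1 x2 x3 x4" "coef SS 2 \<theta> = coeff x2 x3 x4 x1"
    "coef SS 3 \<theta> = coeff x3 x4 x1 x2" "coef SS 4 \<theta> = coeff x4 x1 x2 x3"
    unfolding coef.simps Let_def eig by simp_all
  show ?thesis
    unfolding SS
    \<comment> \<open>The goal left open is that \<open>d2 = d1\<close> holds exactly at
      \<open>\<theta> = 1\<close>.\<close>
    by (rule hand_length_distribution[OF arrow_chain_roots_axioms mat assms _ eig coef]) auto
next
  case WS
  interpret ws_model \<theta>
    using assms by unfold_locales
  obtain x1 x2 x3 x4 where x: "ws_roots \<theta> x1 x2 x3 x4"
    using roots_exist[OF chi_signs] ws_model_axioms by (metis ws_roots.intro)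
  interpret ws_roots \<theta> x1 x2 x3 x4 by fact
  have dist: "distinct [x1, x2, x3, x4]" using x_order by auto
  have eig: "eig WS 1 \<theta> = x1" "eig WS 2 \<theta> = x2" "eig WS 3 \<theta> = x3" "eig WS 4 \<theta> = x4"
    by (simp_all add: eig_def ws_e_eq)
  \<comment> \<open>A cyclic shift of four roots is an odd permutation, whence the minus signs in
    the second and fourth case.\<close>
  have "1 * ws_c x1 x2 x3 x4 \<theta> = coeff x1 x2 x3 x4" "- 1 * ws_c x2 x3 x4 x1 \<theta> = coeff x2 x3 x4 x1"
    "1 * ws_c x3 x4 x1 x2 \<theta> = coeff x3 x4 x1 x2" "- 1 * ws_c x4 x1 x2 x3 \<theta> = coeff x4 x1 x2 x3"
    by (rule ws_c_eq, (use dist in auto)[2], Groebner_Basis.algebra, simp)+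
  then have coef: "coef WS 1 \<theta> = coeff x1 x2 x3 x4" "coef WS 2 \<theta> = coeff x2 x3 x4 x1"
    "coef WS 3 \<theta> = coeff x3 x4 x1 x2" "coef WS 4 \<theta> = coeff x4 x1 x2 x3"
    unfolding coef.simps Let_def eig by simp_all
  show ?thesis
    unfolding WS
    by (rule hand_length_distribution[OF arrow_chain_roots_axioms mat assms _ eig coef]) auto
qed

end
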